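(* Let $d\geq 2$ and let $\mathfrak{g}$ be a Lifshitz Lie algebra of dimension $d(d+1)/2+2$ (as defined in the context). Then $\mathfrak{g}$ is isomorphic to precisely one Lie algebra in the following list. Each algebra in the list has basis $J_{ab}=-J_{ba}$, $P_a$, $H$, $D$ ($a,b=1,\dots,d$), with the common brackets \[ [J_{ab},J_{cd}] = \delta_{bc} J_{ad} - \delta_{ac} J_{bd} - \delta_{bd} J_{ac} + \delta_{ad} J_{bc},\qquad [J_{ab},P_c]=\delta_{bc}P_a-\delta_{ac}P_b,\qquad [J_{ab},H]=[J_{ab},D]=0, \] and in addition only the following nonzero brackets (all brackets not listed and not determined by antisymmetry vanish): \begin{itemize} \item $\mathfrak{a}_1$ ($d\geq 2$): no further nonzero brackets; \item $\mathfrak{a}_2$ ($d\geq 2$): $[D,H]=H$; \item $\mathfrak{a}_3^z$ ($d\geq 2$), for a parameter $z\in\mathbb{R}$: $[D,H]=zH$, $[D,P_a]=P_a$; \item $\mathfrak{a}_4^\pm$ ($d\geq 2$): $[P_a,P_b]=\pm J_{ab}$; \item $\mathfrak{a}_5^\pm$ ($d\geq 2$): $[D,H]=H$, $[P_a,P_b]=\pm J_{ab}$; \item $\mathfrak{a}_6$ (only $d=2$): $[P_a,P_b]=\epsilon_{ab}H$; \item $\mathfrak{a}_7$ (only $d=2$): $[D,H]=2H$, $[D,P_a]=P_a$, $[P_a,P_b]=\epsilon_{ab}H$. \end{itemize}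
   Context: A Lifshitz Lie algebra is a real Lie algebra $\mathfrak{g}$ of dimension $d(d+1)/2+2$ with a basis $J_{ab}=-J_{ba}$, $P_a$, $H$, $D$ ($a,b=1,\dots,d$) such that the $J_{ab}$ span a Lie subalgebra isomorphic to $\mathfrak{so}(d)$ with brackets $[J_{ab},J_{cd}] = \delta_{bc} J_{ad} - \delta_{ac} J_{bd} - \delta_{bd} J_{ac} + \delta_{ad} J_{bc}$, under which the $P_a$ transform as a vector, $[J_{ab},P_c]=\delta_{bc}P_a-\delta_{ac}P_b$, and $H$ and $D$ transform as scalars, $[J_{ab},H]=[J_{ab},D]=0$; the remaining brackets are arbitrary subject only to the Jacobi identity. $\epsilon_{ab}$ denotes the Levi-Civita symbol in two dimensions. *)

theory Defs
  imports "HOL-Analysis.Analysis"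
begin

text \<open>Index set of the standard basis J_ab (a<b), P_a, H, D of a Lifshitz algebra.\<close>
datatype lidx = LJ nat nat | LP nat | LH | LD

definition Idx :: "nat \<Rightarrow> lidx set" where
  "Idx d = {LJ a b | a b. 1 \<le> a \<and> a < b \<and> b \<le> d} \<union> {LP a | a. 1 \<le> a \<and> a \<le> d} \<union> {LH, LD}"

definition lie_algebra :: "('v::real_vector \<Rightarrow> 'v \<Rightarrow> 'v) \<Rightarrow> bool" where
  "lie_algebra br \<longleftrightarrow> bilinear br \<and> (\<forall>x. br x x = 0) \<and>
     (\<forall>x y z. br x (br y z) + br y (br z x) + br z (br x y) = 0)"

definition lie_iso :: "('v::real_vector \<Rightarrow> 'v \<Rightarrow> 'v) \<Rightarrow> ('w::real_vector \<Rightarrow> 'w \<Rightarrow> 'w) \<Rightarrow> ('v \<Rightarrow> 'w) \<Rightarrow> bool" where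
  "lie_iso br1 br2 f \<longleftrightarrow> linear f \<and> bij f \<and> (\<forall>x y. f (br1 x y) = br2 (f x) (f y))"

definition is_basis :: "nat \<Rightarrow> (lidx \<Rightarrow> 'v::real_vector) \<Rightarrow> bool" where
  "is_basis d B \<longleftrightarrow> inj_on B (Idx d) \<and> independent (B ` Idx d) \<and> span (B ` Idx d) = UNIV"

definition kd :: "nat \<Rightarrow> nat \<Rightarrow> real" where
  "kd i j = (if i = j then 1 else 0)"

definition Jv :: "(lidx \<Rightarrow> 'v::real_vector) \<Rightarrow> nat \<Rightarrow> nat \<Rightarrow> 'v" where
  "Jv B a b = (if a < b then B (LJ a b) else if b < a then - B (LJ b a) else 0)"

abbreviation Pv :: "(lidx \<Rightarrow> 'v::real_vector) \<Rightarrow> nat \<Rightarrow> 'v" where "Pv B a \<equiv> B (LP a)"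
abbreviation Hv :: "(lidx \<Rightarrow> 'v::real_vector) \<Rightarrow> 'v" where "Hv B \<equiv> B LH"
abbreviation Dv :: "(lidx \<Rightarrow> 'v::real_vector) \<Rightarrow> 'v" where "Dv B \<equiv> B LD"

definition eps2 :: "nat \<Rightarrow> nat \<Rightarrow> real" where
  "eps2 a b = (if a = 1 \<and> b = 2 then 1 else if a = 2 \<and> b = 1 then -1 else 0)"

definition common_brackets :: "nat \<Rightarrow> ('v::real_vector \<Rightarrow> 'v \<Rightarrow> 'v) \<Rightarrow> (lidx \<Rightarrow> 'v) \<Rightarrow> bool" where
  "common_brackets d br B \<longleftrightarrow>
    (\<forall>a\<in>{1..d}. \<forall>b\<in>{1..d}. \<forall>c\<in>{1..d}. \<forall>e\<in>{1..d}.
       br (Jv B a b) (Jv B c e) = kd b c *\<^sub>R Jv B a e - kd a c *\<^sub>R Jv B b e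
                                 - kd b e *\<^sub>R Jv B a c + kd a e *\<^sub>R Jv B b c) \<and>
    (\<forall>a\<in>{1..d}. \<forall>b\<in>{1..d}. \<forall>c\<in>{1..d}.
       br (Jv B a b) (Pv B c) = kd b c *\<^sub>R Pv B a - kd a c *\<^sub>R Pv B b) \<and>
    (\<forall>a\<in>{1..d}. \<forall>b\<in>{1..d}. br (Jv B a b) (Hv B) = 0 \<and> br (Jv B a b) (Dv B) = 0)"

definition lifshitz :: "nat \<Rightarrow> ('v::real_vector \<Rightarrow> 'v \<Rightarrow> 'v) \<Rightarrow> (lidx \<Rightarrow> 'v) \<Rightarrow> bool" where
  "lifshitz d br B \<longleftrightarrow> lie_algebra br \<and> is_basis d B \<and> common_brackets d br B"

datatype lab = A1 | A2 | A3 real | A4 bool | A5 bool | A6 | A7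

fun valid_lab :: "nat \<Rightarrow> lab \<Rightarrow> bool" where
  "valid_lab d A6 = (d = 2)"
| "valid_lab d A7 = (d = 2)"
| "valid_lab d _ = (2 \<le> d)"

fun sgn_of :: "bool \<Rightarrow> real" where
  "sgn_of True = 1" | "sgn_of False = -1"

fun pp :: "lab \<Rightarrow> (lidx \<Rightarrow> 'v::real_vector) \<Rightarrow> nat \<Rightarrow> nat \<Rightarrow> 'v" where
  "pp (A4 s) B a b = sgn_of s *\<^sub>R Jv B a b"
| "pp (A5 s) B a b = sgn_of s *\<^sub>R Jv B a b"
| "pp A6 B a b = eps2 a b *\<^sub>R Hv B"
| "pp A7 B a b = eps2 a b *\<^sub>R Hv B"
| "pp _ B a b = 0"

fun dh :: "lab \<Rightarrow> real" where
  "dh A2 = 1" | "dh (A3 z) = z" | "dh (A5 s) = 1" | "dh A7 = 2" | "dh _ = 0"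

fun dp :: "lab \<Rightarrow> real" where
  "dp (A3 z) = 1" | "dp A7 = 1" | "dp _ = 0"

definition realises :: "nat \<Rightarrow> lab \<Rightarrow> ('v::real_vector \<Rightarrow> 'v \<Rightarrow> 'v) \<Rightarrow> (lidx \<Rightarrow> 'v) \<Rightarrow> bool" where
  "realises d L br B \<longleftrightarrow> lie_algebra br \<and> is_basis d B \<and> common_brackets d br B \<and>
    (\<forall>a\<in>{1..d}. \<forall>b\<in>{1..d}. br (Pv B a) (Pv B b) = pp L B a b) \<and>
    (\<forall>a\<in>{1..d}. br (Pv B a) (Hv B) = 0 \<and> br (Dv B) (Pv B a) = dp L *\<^sub>R Pv B a) \<and>
    br (Dv B) (Hv B) = dh L *\<^sub>R Hv B"

end

theory Submission
  imports Defs
begin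

text \<open>
  An isomorphism transports bases, so \<open>\<gg>\<close> is isomorphic to a listed algebra iff \<open>\<gg>\<close> itself has a
  basis with the listed brackets.

  Existence: Jacobi with \<open>J\<^sub>a\<^sub>b\<close> makes all remaining brackets rotation equivariant. This leaves few
  free coefficients; the exotic ones (\<open>\<epsilon>\<^sub>a\<^sub>b\<close> for \<open>d = 2\<close>, \<open>\<epsilon>\<^sub>a\<^sub>b\<^sub>c\<close> for \<open>d = 3\<close>, \<open>\<epsilon>\<^sub>a\<^sub>b\<^sub>c\<^sub>d\<close> for \<open>d = 4\<close>)
  are killed by shifting \<open>H\<close>, \<open>D\<close> by \<open>J\<^sub>1\<^sub>2\<close>, by shifting \<open>P\<^sub>a\<close> by the dual of \<open>J\<close>, and by the
  Jacobi identity on \<open>P\<close>, respectively. Then \<open>H\<close> and \<open>D\<close> act on \<open>P\<close> by scalars, and some line in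
  their span commutes with \<open>P\<close> and contains both \<open>[D,H]\<close> and the scalar part of \<open>[P\<^sub>a,P\<^sub>b]\<close>. Choosing
  \<open>H\<close> on that line leaves four structure constants, \<open>[P\<^sub>a,P\<^sub>b] = s J\<^sub>a\<^sub>b + q \<epsilon>\<^sub>a\<^sub>b H\<close>, \<open>[D,P\<^sub>a] = g P\<^sub>a\<close>
  and \<open>[D,H] = z H\<close>, which Jacobi and rescaling reduce to the list.

  Uniqueness: the signs of the constants are read off from properties of the bracket alone. The
  centre is nontrivial iff \<open>z = 0\<close>. Call \<open>v\<close> \<^emph>\<open>ideal\<close> if its span is an ideal; a nonzero ideal
  vector of the form \<open>[[x,y],[x',y']]\<close> detects \<open>q\<close>. For \<open>q = 0\<close> call \<open>x\<close> \<^emph>\<open>hyperbolic\<close> if \<open>[x,y] = y\<close> for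
  some non-ideal \<open>y\<close>. The form \<open>|J|\<^sup>2 - 2s |P|\<^sup>2\<close> is invariant, hence for \<open>s \<le> 0\<close> a hyperbolic \<open>x\<close>
  has \<open>D\<close>-coordinate \<open>1/g\<close>; so \<open>x\<close> and \<open>-x\<close> can both be hyperbolic only if \<open>s > 0\<close>. For \<open>s < 0\<close> the
  form is definite modulo \<open>H\<close> and \<open>D\<close>, so \<open>[x,[x,y]] = 0\<close> forces \<open>[x,y]\<close> to be ideal, in contrast to
  \<open>s = 0\<close>. Finally, if \<open>g = 1\<close> every hyperbolic \<open>x\<close> acts on the ideal line by \<open>z\<close>.
\<close>

declare One_nat_def [simp del] atLeastAtMost_iff [simp del]

section \<open>Coordinates\<close>

lemma finite_Idx [simp]: "finite (Idx d)"
proof -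
  have "Idx d \<subseteq> (\<lambda>(a, b). LJ a b) ` ({..d} \<times> {..d}) \<union> LP ` {..d} \<union> {LH, LD}"
    unfolding Idx_def by auto
  then show ?thesis
    by (rule finite_subset) auto
qed

lemma Idx_mem:
  "1 \<le> a \<Longrightarrow> a < b \<Longrightarrow> b \<le> d \<Longrightarrow> LJ a b \<in> Idx d"
  "a \<in> {1..d} \<Longrightarrow> LP a \<in> Idx d" "LH \<in> Idx d" "LD \<in> Idx d"
  by (auto simp: Idx_def atLeastAtMost_iff)

lemma kd_commute: "kd i j = kd j i"
  by (simp add: kd_def)

lemma kd_simps [simp]: "kd i i = 1" "i \<noteq> j \<Longrightarrow> kd i j = 0"
  by (simp_all add: kd_def)

lemma sum_kd_mult [simp]:
  assumes "finite S" "a \<in> S"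
  shows "(\<Sum>k\<in>S. kd a k * f k) = f a"
  using assms by (simp add: kd_def if_distrib[of "\<lambda>t. t * _"] cong: if_cong)

lemma Jv_commute: "Jv B a b = - Jv B b a"
  by (simp add: Jv_def)

lemma Jv_refl [simp]: "Jv B a a = 0"
  by (simp add: Jv_def)

lemma eps2_eq_kd: "eps2 a b = kd 1 a * kd 2 b - kd 2 a * kd 1 b"
  by (auto simp: eps2_def kd_def)

lemma is_basis_if_spans:
  fixes B B' :: "lidx \<Rightarrow> 'v::real_vector"
  assumes basis: "is_basis d B" and spans: "\<And>i. i \<in> Idx d \<Longrightarrow> B i \<in> span (B' ` Idx d)"
  shows "is_basis d B'"
proof -
  let ?S = "B' ` Idx d"
  have "span (B ` Idx d) \<subseteq> span ?S"
    using spans by (intro span_minimal) auto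
  then have span_S: "span ?S = UNIV"
    using basis by (auto simp: is_basis_def)
  obtain T where T: "T \<subseteq> ?S" "independent T" "?S \<subseteq> span T"
    by (rule maximal_independent_subset)
  then have span_T: "span T = UNIV"
    by (metis span_S span_minimal subspace_span top.extremum_uniqueI)
  have "card T = card (B ` Idx d)"
    using basis T span_T dim_eq_card[of T UNIV] dim_eq_card[of "B ` Idx d" UNIV]
    by (simp add: is_basis_def)
  also have "\<dots> = card (Idx d)"
    using basis by (simp add: is_basis_def card_image)
  finally have card_T: "card T = card (Idx d)" .
  have "T = ?S"
    using T(1) by (rule card_seteq[rotated]) (simp_all add: card_T card_image_le)
  moreover have "inj_on B' (Idx d)"
    using card_T by (intro eq_card_imp_inj_on) (simp_all add: \<open>T = ?S\<close>)
  ultimately show ?thesis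
    using T(2) span_S by (simp add: is_basis_def)
qed

lemma is_basis_image:
  assumes "is_basis d B" "linear g" "bij g"
  shows "is_basis d (g \<circ> B)"
proof -
  have "inj g" "surj g"
    using assms(3) by (auto simp: bij_def)
  then have "independent (g ` B ` Idx d)" "span (g ` B ` Idx d) = UNIV" "inj_on (g \<circ> B) (Idx d)"
    using assms linear_independent_injective_image[of g] linear_span_image[of g]
    by (auto simp: is_basis_def inj_on_def)
  then show ?thesis
    by (simp add: is_basis_def image_comp)
qed

locale indexed_basis =
  fixes d :: nat and B :: "lidx \<Rightarrow> 'v::real_vector"
  assumes d_ge_2: "2 \<le> d" and basis: "is_basis d B"
begin

lemma one_mem [simp]: "1 \<in> {1..d}" and two_mem [simp]: "2 \<in> {1..d}"
  using d_ge_2 by (auto simp: atLeastAtMost_iff)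

lemma independent_basis: "independent (B ` Idx d)" and in_span_basis: "x \<in> span (B ` Idx d)"
  using basis by (auto simp: is_basis_def)

definition coord :: "lidx \<Rightarrow> 'v \<Rightarrow> real" where
  "coord i x = representation (B ` Idx d) x (B i)"

definition coordJ :: "nat \<Rightarrow> nat \<Rightarrow> 'v \<Rightarrow> real" where
  "coordJ m n x = (if m < n then coord (LJ m n) x else if n < m then - coord (LJ n m) x else 0)"

definition coordP :: "nat \<Rightarrow> 'v \<Rightarrow> real" where
  "coordP n = coord (LP n)"

definition coordH :: "'v \<Rightarrow> real" where
  "coordH = coord LH"

definition coordD :: "'v \<Rightarrow> real" where
  "coordD = coord LD"

lemma linear_coord: "linear (coord i)"
  unfolding coord_def
  by (intro linearI)
    (simp_all add: representation_add[OF independent_basis] representation_scale[OF independent_basis]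
      in_span_basis)

lemma linear_coordJ: "linear (coordJ m n)"
proof -
  have "linear (\<lambda>x. - coord (LJ n m) x)"
    by (intro linear_compose_neg linear_coord)
  then show ?thesis
    unfolding coordJ_def using linear_coord linear_zero
    by (cases m n rule: linorder_cases) simp_all
qed

lemma linear_coordP: "linear (coordP n)"
  and linear_coordH: "linear coordH"
  and linear_coordD: "linear coordD"
  unfolding coordP_def coordH_def coordD_def by (rule linear_coord)+

lemmas linear_coords = linear_coordJ linear_coordP linear_coordH linear_coordD

lemmas coord_linear_simps [simp] =
  linear_coords[THEN linear_add] linear_coords[THEN linear_diff]
  linear_coords[THEN linear_scale] linear_coords[THEN linear_neg]
  linear_coords[THEN linear_0]

lemma coord_basis: "i \<in> Idx d \<Longrightarrow> j \<in> Idx d \<Longrightarrow> coord i (B j) = (if i = j then 1 else 0)"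
  using basis representation_basis[of "B ` Idx d" "B j"]
  by (auto simp: is_basis_def coord_def inj_on_def)

lemma coordJ_commute: "coordJ m n x = - coordJ n m x"
  by (simp add: coordJ_def)

lemma coordJ_refl [simp]: "coordJ m m x = 0"
  by (simp add: coordJ_def)

lemmas coord_of_basis_defs = coordJ_def coordP_def coordH_def coordD_def Jv_def kd_def
  coord_basis Idx_mem linear_neg[OF linear_coord] linear_0[OF linear_coord] atLeastAtMost_iff

lemma coordJ_basis [simp]:
  assumes "m \<in> {1..d}" "n \<in> {1..d}"
  shows "a \<in> {1..d} \<Longrightarrow> b \<in> {1..d} \<Longrightarrow> coordJ m n (Jv B a b) = kd m a * kd n b - kd m b * kd n a"
    "a \<in> {1..d} \<Longrightarrow> coordJ m n (Pv B a) = 0" "coordJ m n (Hv B) = 0" "coordJ m n (Dv B) = 0"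
  using assms by (auto simp: coord_of_basis_defs)

lemma coordP_basis [simp]:
  assumes "n \<in> {1..d}"
  shows "a \<in> {1..d} \<Longrightarrow> b \<in> {1..d} \<Longrightarrow> coordP n (Jv B a b) = 0"
    "a \<in> {1..d} \<Longrightarrow> coordP n (Pv B a) = kd n a" "coordP n (Hv B) = 0" "coordP n (Dv B) = 0"
  using assms by (auto simp: coord_of_basis_defs)

lemma coordH_basis [simp]:
  "a \<in> {1..d} \<Longrightarrow> b \<in> {1..d} \<Longrightarrow> coordH (Jv B a b) = 0"
  "a \<in> {1..d} \<Longrightarrow> coordH (Pv B a) = 0" "coordH (Hv B) = 1" "coordH (Dv B) = 0"
  by (auto simp: coord_of_basis_defs)

lemma coordD_basis [simp]:
  "a \<in> {1..d} \<Longrightarrow> b \<in> {1..d} \<Longrightarrow> coordD (Jv B a b) = 0"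
  "a \<in> {1..d} \<Longrightarrow> coordD (Pv B a) = 0" "coordD (Hv B) = 0" "coordD (Dv B) = 1"
  by (auto simp: coord_of_basis_defs)

lemma linear_eq_on_basis:
  assumes "linear f" "linear g"
    and J: "\<And>a b. a \<in> {1..d} \<Longrightarrow> b \<in> {1..d} \<Longrightarrow> f (Jv B a b) = g (Jv B a b)"
    and "\<And>a. a \<in> {1..d} \<Longrightarrow> f (Pv B a) = g (Pv B a)"
    and "f (Hv B) = g (Hv B)" "f (Dv B) = g (Dv B)"
  shows "f x = g x"
proof (rule linear_eq_on_span[OF assms(1,2) _ in_span_basis])
  have "f (B (LJ a b)) = g (B (LJ a b))" if "1 \<le> a" "a < b" "b \<le> d" for a b
    using J[of a b] that by (simp add: Jv_def atLeastAtMost_iff)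
  then show "f y = g y" if "y \<in> B ` Idx d" for y
    using that assms(4-6) by (auto simp: Idx_def atLeastAtMost_iff)
qed

lemma coord_eqI:
  assumes "\<And>m n. m \<in> {1..d} \<Longrightarrow> n \<in> {1..d} \<Longrightarrow> coordJ m n x = coordJ m n y"
    and "\<And>n. n \<in> {1..d} \<Longrightarrow> coordP n x = coordP n y" and "coordH x = coordH y" "coordD x = coordD y"
  shows "x = y"
proof -
  have "coord (LJ m n) x = coord (LJ m n) y" if "1 \<le> m" "m < n" "n \<le> d" for m n
    using assms(1)[of m n] that by (simp add: coordJ_def atLeastAtMost_iff)
  then have "coord i x = coord i y" if "i \<in> Idx d" for i
    using that assms(2-4) by (auto simp: Idx_def coordP_def coordH_def coordD_def atLeastAtMost_iff)
  then have "representation (B ` Idx d) x v = representation (B ` Idx d) y v" for v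
    by (metis coord_def image_iff representation_ne_zero)
  then have "representation (B ` Idx d) x = representation (B ` Idx d) y"
    by (rule ext)
  then show ?thesis
    by (metis independent_basis in_span_basis sum_nonzero_representation_eq)
qed

definition formJ :: "'v \<Rightarrow> 'v \<Rightarrow> real" where
  "formJ x y = (\<Sum>m\<in>{1..d}. \<Sum>n\<in>{1..d}. coordJ m n x * coordJ m n y)"

definition formP :: "'v \<Rightarrow> 'v \<Rightarrow> real" where
  "formP x y = (\<Sum>n\<in>{1..d}. coordP n x * coordP n y)"

lemma formJ_commute: "formJ x y = formJ y x" and formP_commute: "formP x y = formP y x"
  by (simp_all add: formJ_def formP_def mult.commute)

lemma linear_formJ_left: "linear (\<lambda>x. formJ x y)" and linear_formP_left: "linear (\<lambda>x. formP x y)"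
  by (auto intro!: linearI simp: formJ_def formP_def sum.distrib sum_distrib_left algebra_simps)

lemma linear_formJ_right: "linear (formJ x)" and linear_formP_right: "linear (formP x)"
  using linear_formJ_left[of x] linear_formP_left[of x]
  unfolding formJ_commute[of _ x] formP_commute[of _ x] by simp_all

lemmas linear_forms = linear_formJ_left linear_formP_left linear_formJ_right linear_formP_right

lemmas form_linear_simps [simp] =
  linear_forms[THEN linear_add] linear_forms[THEN linear_scale]
  linear_forms[THEN linear_neg] linear_forms[THEN linear_0]

lemma formP_nonneg: "0 \<le> formP x x" and formJ_nonneg: "0 \<le> formJ x x"
  by (auto simp: formJ_def formP_def intro!: sum_nonneg)

lemma formP_self_eq_0:
  assumes "formP x x = 0" "n \<in> {1..d}"
  shows "coordP n x = 0"
  using assms by (auto simp: formP_def sum_nonneg_eq_0_iff)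

lemma formJ_self_eq_0:
  assumes "formJ x x = 0" "m \<in> {1..d}" "n \<in> {1..d}"
  shows "coordJ m n x = 0"
  using assms by (auto simp: formJ_def sum_nonneg_eq_0_iff sum_nonneg)

end

locale lie_bracket =
  fixes br :: "'v::real_vector \<Rightarrow> 'v \<Rightarrow> 'v"
  assumes lie: "lie_algebra br"
begin

lemma linear_br_right: "linear (br x)" and linear_br_left: "linear (\<lambda>x. br x y)"
  using lie by (auto simp: lie_algebra_def bilinear_def)

lemmas br_linear_simps [simp] =
  linear_br_right[THEN linear_add] linear_br_left[THEN linear_add]
  linear_br_right[THEN linear_diff] linear_br_left[THEN linear_diff]
  linear_br_right[THEN linear_scale] linear_br_left[THEN linear_scale]
  linear_br_right[THEN linear_neg] linear_br_left[THEN linear_neg]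
  linear_br_right[THEN linear_0] linear_br_left[THEN linear_0]

lemma br_self [simp]: "br x x = 0"
  using lie by (auto simp: lie_algebra_def)

lemma br_commute: "br x y = - br y x"
proof -
  have "br x y + br y x = br (x + y) (x + y)"
    by (simp del: br_self add: br_self[of x] br_self[of y])
  then show ?thesis
    by (simp add: eq_neg_iff_add_eq_0)
qed

lemma jacobi: "br x (br y z) + br y (br z x) + br z (br x y) = 0"
  using lie by (auto simp: lie_algebra_def)

lemma br_derivation: "br x (br y z) = br (br x y) z + br y (br x z)"
proof -
  have "br y (br z x) = - br y (br x z)" "br z (br x y) = - br (br x y) z"
    using br_commute[of z x] br_commute[of z "br x y"] by simp_all
  then show ?thesis
    using jacobi[of x y z] by (simp add: algebra_simps)
qed

end

section \<open>Equivariance under rotations\<close>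

locale lifshitz_algebra = indexed_basis d B + lie_bracket br
  for d and B :: "lidx \<Rightarrow> 'v::real_vector" and br +
  assumes common: "common_brackets d br B"
begin

lemma br_JJ: "\<lbrakk>a \<in> {1..d}; b \<in> {1..d}; c \<in> {1..d}; e \<in> {1..d}\<rbrakk> \<Longrightarrow>
    br (Jv B a b) (Jv B c e) = kd b c *\<^sub>R Jv B a e - kd a c *\<^sub>R Jv B b e
      - kd b e *\<^sub>R Jv B a c + kd a e *\<^sub>R Jv B b c"
  and br_JP: "\<lbrakk>a \<in> {1..d}; b \<in> {1..d}; c \<in> {1..d}\<rbrakk> \<Longrightarrow>
    br (Jv B a b) (Pv B c) = kd b c *\<^sub>R Pv B a - kd a c *\<^sub>R Pv B b"
  and br_JH: "\<lbrakk>a \<in> {1..d}; b \<in> {1..d}\<rbrakk> \<Longrightarrow> br (Jv B a b) (Hv B) = 0"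
  and br_JD: "\<lbrakk>a \<in> {1..d}; b \<in> {1..d}\<rbrakk> \<Longrightarrow> br (Jv B a b) (Dv B) = 0"
  using common unfolding common_brackets_def by blast+

lemmas br_J = br_JJ br_JP br_JH br_JD

lemma br_PJ: "\<lbrakk>a \<in> {1..d}; b \<in> {1..d}; c \<in> {1..d}\<rbrakk> \<Longrightarrow>
    br (Pv B c) (Jv B a b) = kd a c *\<^sub>R Pv B b - kd b c *\<^sub>R Pv B a"
  using br_commute[of "Pv B c" "Jv B a b"] by (simp add: br_J)

lemma
  assumes "a \<in> {1..d}" "b \<in> {1..d}"
  shows coordJ_br_J: "m \<in> {1..d} \<Longrightarrow> n \<in> {1..d} \<Longrightarrow> coordJ m n (br (Jv B a b) x) =
      kd a m * coordJ b n x - kd b m * coordJ a n x - kd b n * coordJ m a x + kd a n * coordJ m b x"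
    and coordP_br_J: "n \<in> {1..d} \<Longrightarrow>
      coordP n (br (Jv B a b) x) = kd a n * coordP b x - kd b n * coordP a x"
    and coordH_br_J: "coordH (br (Jv B a b) x) = 0"
    and coordD_br_J: "coordD (br (Jv B a b) x) = 0"
proof -
  show "coordJ m n (br (Jv B a b) x) =
      kd a m * coordJ b n x - kd b m * coordJ a n x - kd b n * coordJ m a x + kd a n * coordJ m b x"
    if "m \<in> {1..d}" "n \<in> {1..d}"
    by (rule linear_eq_on_basis)
      (use that assms in \<open>auto intro!: linearI simp: br_J kd_commute algebra_simps\<close>)
  show "coordP n (br (Jv B a b) x) = kd a n * coordP b x - kd b n * coordP a x" if "n \<in> {1..d}"
    by (rule linear_eq_on_basis)
      (use that assms in \<open>auto intro!: linearI simp: br_J kd_commute algebra_simps\<close>)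
  show "coordH (br (Jv B a b) x) = 0" "coordD (br (Jv B a b) x) = 0"
    by (rule linear_eq_on_basis; use assms in \<open>auto intro!: linearI simp: br_J\<close>)+
qed

lemma coordP_eq_0_if_commutes:
  assumes "br (Jv B a b) x = 0" "a \<in> {1..d}" "b \<in> {1..d}" "a \<noteq> b"
  shows "coordP a x = 0" "coordP b x = 0"
  using assms coordP_br_J[of a b b x] coordP_br_J[of a b a x] by simp_all

lemma coordJ_eq_0_if_commutes:
  assumes "br (Jv B a b) x = 0" "a \<in> {1..d}" "b \<in> {1..d}" "a \<noteq> b"
    and "n \<in> {1..d}" "n \<noteq> a" "n \<noteq> b"
  shows "coordJ a n x = 0" "coordJ b n x = 0"
  using assms coordJ_br_J[of a b b n x] coordJ_br_J[of a b a n x] by simp_all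

definition invariant :: "'v \<Rightarrow> bool" where
  "invariant K \<longleftrightarrow> (\<forall>a\<in>{1..d}. \<forall>b\<in>{1..d}. br (Jv B a b) K = 0)"

definition vector_family :: "(nat \<Rightarrow> 'v) \<Rightarrow> bool" where
  "vector_family X \<longleftrightarrow> (\<forall>a\<in>{1..d}. \<forall>b\<in>{1..d}. \<forall>c\<in>{1..d}.
    br (Jv B a b) (X c) = kd b c *\<^sub>R X a - kd a c *\<^sub>R X b)"

definition bivector_family :: "(nat \<Rightarrow> nat \<Rightarrow> 'v) \<Rightarrow> bool" where
  "bivector_family T \<longleftrightarrow> (\<forall>a b. T a b = - T b a) \<and>
    (\<forall>a\<in>{1..d}. \<forall>b\<in>{1..d}. \<forall>c\<in>{1..d}. \<forall>e\<in>{1..d}.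
      br (Jv B a b) (T c e) = kd b c *\<^sub>R T a e - kd a c *\<^sub>R T b e - kd b e *\<^sub>R T a c + kd a e *\<^sub>R T b c)"

lemma invariantD: "invariant K \<Longrightarrow> a \<in> {1..d} \<Longrightarrow> b \<in> {1..d} \<Longrightarrow> br (Jv B a b) K = 0"
  by (simp add: invariant_def)

lemma invariant_H: "invariant (Hv B)" and invariant_D: "invariant (Dv B)"
  by (simp_all add: invariant_def br_J)

lemma invariant_add: "invariant K \<Longrightarrow> invariant K' \<Longrightarrow> invariant (K + K')"
  and invariant_scaleR: "invariant K \<Longrightarrow> invariant (r *\<^sub>R K)"
  and invariant_br: "invariant K \<Longrightarrow> invariant K' \<Longrightarrow> invariant (br K K')"
  by (simp_all add: invariant_def br_derivation[of "Jv B _ _"])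

lemma vector_familyD:
  "vector_family X \<Longrightarrow> a \<in> {1..d} \<Longrightarrow> b \<in> {1..d} \<Longrightarrow> c \<in> {1..d} \<Longrightarrow>
    br (Jv B a b) (X c) = kd b c *\<^sub>R X a - kd a c *\<^sub>R X b"
  by (simp add: vector_family_def)

lemma vector_family_P: "vector_family (Pv B)"
  by (simp add: vector_family_def br_J)

lemma vector_family_add: "vector_family X \<Longrightarrow> vector_family Y \<Longrightarrow> vector_family (\<lambda>a. X a + Y a)"
  and vector_family_scaleR: "vector_family X \<Longrightarrow> vector_family (\<lambda>a. r *\<^sub>R X a)"
  and vector_family_br: "invariant K \<Longrightarrow> vector_family X \<Longrightarrow> vector_family (\<lambda>a. br K (X a))"
  by (simp_all add: vector_family_def invariant_def br_derivation[of "Jv B _ _"]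
      scaleR_add_right scaleR_diff_right mult.commute)

lemma bivector_family_anti: "bivector_family T \<Longrightarrow> T a b = - T b a"
  unfolding bivector_family_def by blast

lemma bivector_familyD:
  "bivector_family T \<Longrightarrow> a \<in> {1..d} \<Longrightarrow> b \<in> {1..d} \<Longrightarrow> c \<in> {1..d} \<Longrightarrow> e \<in> {1..d} \<Longrightarrow>
    br (Jv B a b) (T c e) = kd b c *\<^sub>R T a e - kd a c *\<^sub>R T b e - kd b e *\<^sub>R T a c + kd a e *\<^sub>R T b c"
  unfolding bivector_family_def by blast

lemma bivector_family_J: "bivector_family (Jv B)"
  unfolding bivector_family_def by (intro conjI allI ballI Jv_commute br_JJ)

lemma bivector_family_scaleR:
  assumes "bivector_family T"
  shows "bivector_family (\<lambda>a b. r *\<^sub>R T a b)"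
  unfolding bivector_family_def
proof (intro conjI allI ballI)
  show "r *\<^sub>R T a b = - (r *\<^sub>R T b a)" for a b
    using bivector_family_anti[OF assms, of a b] by simp
qed (simp add: bivector_familyD[OF assms] scaleR_add_right scaleR_diff_right mult.commute)

lemma bivector_family_br:
  assumes "vector_family X"
  shows "bivector_family (\<lambda>a b. br (X a) (X b))"
  unfolding bivector_family_def
proof (intro conjI allI ballI)
  show "br (X a) (X b) = - br (X b) (X a)" for a b
    by (rule br_commute)
  fix a b c e assume "a \<in> {1..d}" "b \<in> {1..d}" "c \<in> {1..d}" "e \<in> {1..d}"
  then show "br (Jv B a b) (br (X c) (X e)) = kd b c *\<^sub>R br (X a) (X e) - kd a c *\<^sub>R br (X b) (X e)
      - kd b e *\<^sub>R br (X a) (X c) + kd a e *\<^sub>R br (X b) (X c)"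
    using br_commute[of "X c" "X a"] br_commute[of "X c" "X b"]
    by (simp add: br_derivation[of "Jv B a b"] vector_familyD[OF assms])
qed

lemma vector_family_rotate:
  assumes "vector_family X" "a \<in> {1..d}" "c \<in> {1..d}" "a \<noteq> c"
  shows "X a = br (Jv B a c) (X c)"
  using vector_familyD[OF assms(1), of a c c] assms by simp

lemma vector_family_eqI:
  assumes X: "vector_family X" and Y: "vector_family Y" and "X 1 = Y 1" "a \<in> {1..d}"
  shows "X a = Y a"
  using vector_family_rotate[OF X, of a 1] vector_family_rotate[OF Y, of a 1] assms
  by (cases "a = 1") simp_all

lemma bivector_family_rotate:
  assumes "bivector_family T" "a \<in> {1..d}" "b \<in> {1..d}" "c \<in> {1..d}" "a \<noteq> b" "a \<noteq> c" "b \<noteq> c"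
  shows "T a b = br (Jv B a c) (T c b)"
  using bivector_familyD[OF assms(1), of a c c b] assms by simp

lemma bivector_family_self:
  assumes "bivector_family T"
  shows "T a a = 0"
proof -
  have "T a a + T a a = 0"
    using bivector_family_anti[OF assms, of a a] by (simp only: eq_neg_iff_add_eq_0)
  then show ?thesis
    by (simp flip: scaleR_2)
qed

lemma bivector_family_eqI:
  assumes T: "bivector_family T" and S: "bivector_family S" and eq_12: "T 1 2 = S 1 2"
    and ab: "a \<in> {1..d}" "b \<in> {1..d}"
  shows "T a b = S a b"
proof -
  note self = bivector_family_self[OF T] bivector_family_self[OF S]
  note anti = bivector_family_anti[OF T] bivector_family_anti[OF S]
  have col: "T a 2 = S a 2" if "a \<in> {1..d}" for a
    using bivector_family_rotate[OF T that, of 2 1] bivector_family_rotate[OF S that, of 2 1] eq_12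
      that self
    by (cases "a = 1 \<or> a = 2") auto
  then have row: "T 2 b = S 2 b" if "b \<in> {1..d}" for b
    using that anti by metis
  consider "a = b" | "a = 2" | "b = 2" | (distinct) "a \<noteq> b" "a \<noteq> 2" "b \<noteq> 2"
    by blast
  then show ?thesis
  proof cases
    case distinct
    then have "T a b = br (Jv B a 2) (T 2 b)" "S a b = br (Jv B a 2) (S 2 b)"
      using ab bivector_family_rotate T S by auto
    then show ?thesis
      using row ab by simp
  qed (use ab self row col in auto)
qed

end

lemma exists_index_notin:
  fixes S :: "nat set"
  assumes "finite S" "card S < d"
  obtains c where "c \<in> {1..d}" "c \<notin> S"
proof -
  have "\<not> {1..d} \<subseteq> S"
    using card_mono[OF assms(1), of "{1..d}"] assms(2) by auto
  then show ?thesis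
    using that by blast
qed

context lifshitz_algebra
begin

lemma obtain_other_index:
  obtains c where "c \<in> {1..d}" "c \<noteq> a"
  using exists_index_notin[of "{a}" d] d_ge_2 by auto

lemma obtain_third_index:
  assumes "3 \<le> d"
  obtains c where "c \<in> {1..d}" "c \<noteq> a" "c \<noteq> b"
  by (rule exists_index_notin[of "set [a, b]" d])
    (use card_length[of "[a, b]"] assms that in auto)

lemma obtain_fourth_index:
  assumes "4 \<le> d"
  obtains c where "c \<in> {1..d}" "c \<noteq> a" "c \<noteq> b" "c \<noteq> n"
  by (rule exists_index_notin[of "set [a, b, n]" d])
    (use card_length[of "[a, b, n]"] assms that in auto)

lemma invariant_coordP:
  assumes "invariant K" "n \<in> {1..d}"
  shows "coordP n K = 0"
proof -
  obtain m where "m \<in> {1..d}" "m \<noteq> n"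
    by (rule obtain_other_index)
  then show ?thesis
    using assms by (intro coordP_eq_0_if_commutes(2)[of m n] invariantD) auto
qed

lemma invariant_coordJ:
  assumes "invariant K" "3 \<le> d" "m \<in> {1..d}" "n \<in> {1..d}"
  shows "coordJ m n K = 0"
proof (cases "m = n")
  case False
  obtain a where "a \<in> {1..d}" "a \<noteq> m" "a \<noteq> n"
    using \<open>3 \<le> d\<close> by (rule obtain_third_index)
  then show ?thesis
    using assms False by (intro coordJ_eq_0_if_commutes(1)[of m a] invariantD) auto
qed simp

lemma invariant_eq:
  assumes K: "invariant K"
  shows "K = coordJ 1 2 K *\<^sub>R Jv B 1 2 + (coordH K *\<^sub>R Hv B + coordD K *\<^sub>R Dv B)" (is "_ = ?R")
proof (rule coord_eqI)
  show "coordJ m n K = coordJ m n ?R" if mn: "m \<in> {1..d}" "n \<in> {1..d}" for m n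
  proof (cases "3 \<le> d")
    case True
    then show ?thesis
      using invariant_coordJ[OF K] mn by simp
  next
    case False
    then have "(m = 1 \<or> m = 2) \<and> (n = 1 \<or> n = 2)"
      using mn by (auto simp: atLeastAtMost_iff)
    then show ?thesis
      using coordJ_commute[of 2 1 K] by auto
  qed
qed (use invariant_coordP[OF K] in simp_all)

lemma vector_family_coords:
  assumes X: "vector_family X"
  shows "coordH (X 1) = 0"
    and "coordD (X 1) = 0"
    and vector_family_coordJ: "n \<in> {1..d} \<Longrightarrow> coordJ 1 n (X 1) = 0"
proof -
  show "coordH (X 1) = 0" "coordD (X 1) = 0"
    using vector_family_rotate[OF X, of 1 2] coordH_br_J[of 1 2 "X 2"] coordD_br_J[of 1 2 "X 2"]
    by simp_all
  show "coordJ 1 n (X 1) = 0" if "n \<in> {1..d}"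
    using that vector_family_rotate[OF X, of 1 n] coordJ_br_J[of 1 n 1 n "X n"]
    by (cases "n = 1") simp_all
qed

lemma vector_family_commutes:
  assumes "vector_family X" "m \<in> {1..d}" "n \<in> {1..d}" "m \<noteq> 1" "n \<noteq> 1"
  shows "br (Jv B m n) (X 1) = 0"
  using vector_familyD[OF assms(1-3), of 1] assms by simp

lemma vector_family_coordP_off:
  assumes X: "vector_family X" and "3 \<le> d" "n \<in> {1..d}" "n \<noteq> 1"
  shows "coordP n (X 1) = 0"
proof -
  obtain m where "m \<in> {1..d}" "m \<noteq> 1" "m \<noteq> n"
    using \<open>3 \<le> d\<close> by (rule obtain_third_index)
  then show ?thesis
    using assms by (intro coordP_eq_0_if_commutes(1)[of n m] vector_family_commutes[OF X]) auto
qed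

lemma vector_family_coordJ_off:
  assumes X: "vector_family X" and "4 \<le> d" "m \<in> {1..d}" "n \<in> {1..d}"
  shows "coordJ m n (X 1) = 0"
proof -
  consider "m = 1" | "n = 1" | "m = n" | (distinct) "m \<noteq> 1" "n \<noteq> 1" "m \<noteq> n"
    by blast
  then show ?thesis
  proof cases
    case distinct
    obtain k where "k \<in> {1..d}" "k \<noteq> 1" "k \<noteq> m" "k \<noteq> n"
      using \<open>4 \<le> d\<close> by (rule obtain_fourth_index)
    then show ?thesis
      using assms distinct
      by (intro coordJ_eq_0_if_commutes(1)[of m k] vector_family_commutes[OF X]) auto
  qed (use vector_family_coordJ[OF X] coordJ_commute[of m 1 "X 1"] assms in auto)
qed

lemma vector_family_ge_4:
  assumes X: "vector_family X" and "4 \<le> d"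
  shows "\<exists>k. \<forall>a\<in>{1..d}. X a = k *\<^sub>R Pv B a"
proof -
  have "X 1 = coordP 1 (X 1) *\<^sub>R Pv B 1"
  proof (rule coord_eqI)
    show "coordP n (X 1) = coordP n (coordP 1 (X 1) *\<^sub>R Pv B 1)" if "n \<in> {1..d}" for n
      using that vector_family_coordP_off[OF X, of n] \<open>4 \<le> d\<close> by (cases "n = 1") simp_all
  qed (use vector_family_coordJ_off[OF X] vector_family_coords[OF X] \<open>4 \<le> d\<close> in simp_all)
  then show ?thesis
    using vector_family_eqI[OF X vector_family_scaleR[OF vector_family_P]] by blast
qed

text \<open>For \<open>d = 3\<close> bivectors are dual to vectors, so that \<open>J\<close> provides a second vector, which can mix
  with \<open>P\<close>.\<close>

definition hodge :: "(nat \<Rightarrow> nat \<Rightarrow> 'v) \<Rightarrow> nat \<Rightarrow> 'v" where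
  "hodge T c = (if c = 1 then T 2 3 else if c = 2 then T 3 1 else T 1 2)"

lemma index_mem_3:
  assumes "d = 3"
  shows "n \<in> {1..d} \<longleftrightarrow> n = 1 \<or> n = 2 \<or> n = 3"
  using assms by (auto simp: atLeastAtMost_iff)

lemma vector_family_hodge:
  assumes "d = 3" and T: "bivector_family T"
  shows "vector_family (hodge T)"
  unfolding vector_family_def
proof (intro ballI)
  fix a b c assume abc: "a \<in> {1..d}" "b \<in> {1..d}" "c \<in> {1..d}"
  note [simp] = bivector_family_self[OF T] index_mem_3[OF \<open>d = 3\<close>]
    bivector_family_anti[OF T, of 2 1] bivector_family_anti[OF T, of 3 2]
    bivector_family_anti[OF T, of 1 3]
  show "br (Jv B a b) (hodge T c) = kd b c *\<^sub>R hodge T a - kd a c *\<^sub>R hodge T b"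
    using abc[unfolded index_mem_3[OF \<open>d = 3\<close>]]
    by (elim disjE) (simp_all add: hodge_def bivector_familyD[OF T])
qed

lemma vector_family_3:
  assumes "d = 3" and X: "vector_family X"
  shows "\<exists>k l. \<forall>a\<in>{1..d}. X a = k *\<^sub>R Pv B a + l *\<^sub>R hodge (Jv B) a"
proof -
  note [simp] = index_mem_3[OF \<open>d = 3\<close>]
  have "3 \<le> d" "3 \<in> {1..d}"
    using \<open>d = 3\<close> by (simp_all add: atLeastAtMost_iff)
  let ?R = "\<lambda>a. coordP 1 (X 1) *\<^sub>R Pv B a + coordJ 2 3 (X 1) *\<^sub>R hodge (Jv B) a"
  have "X 1 = ?R 1"
  proof (rule coord_eqI)
    show "coordP n (X 1) = coordP n (?R 1)" if "n \<in> {1..d}" for n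
      using that vector_family_coordP_off[OF X \<open>3 \<le> d\<close>, of n]
      by (cases "n = 1") (simp_all add: hodge_def \<open>3 \<in> {1..d}\<close> del: index_mem_3[OF \<open>d = 3\<close>])
    show "coordJ m n (X 1) = coordJ m n (?R 1)" if "m \<in> {1..d}" "n \<in> {1..d}" for m n
      using that[unfolded index_mem_3[OF \<open>d = 3\<close>]]
        vector_family_coordJ[OF X, of 2] vector_family_coordJ[OF X, of 3]
        coordJ_commute[of 2 1 "X 1"] coordJ_commute[of 3 1 "X 1"] coordJ_commute[of 3 2 "X 1"]
      by (elim disjE) (simp_all add: hodge_def)
  qed (use vector_family_coords[OF X] in \<open>simp_all add: hodge_def\<close>)
  moreover have "vector_family ?R"
    using vector_family_hodge[OF \<open>d = 3\<close> bivector_family_J]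
    by (intro vector_family_add vector_family_scaleR vector_family_P)
  ultimately show ?thesis
    using vector_family_eqI[OF X] by blast
qed

lemma index_mem_2:
  assumes "d = 2"
  shows "n \<in> {1..d} \<longleftrightarrow> n = 1 \<or> n = 2"
  using assms by (auto simp: atLeastAtMost_iff)

lemma invariant_J_2:
  assumes "d = 2"
  shows "invariant (Jv B 1 2)"
  using Jv_commute[of B 2 1] by (auto simp: invariant_def index_mem_2[OF assms])

lemma vector_family_2:
  assumes "d = 2" and X: "vector_family X"
  shows "\<exists>k l. \<forall>a\<in>{1..d}. X a = k *\<^sub>R Pv B a + l *\<^sub>R br (Jv B 1 2) (Pv B a)"
proof -
  let ?R = "\<lambda>a. coordP 1 (X 1) *\<^sub>R Pv B a + (- coordP 2 (X 1)) *\<^sub>R br (Jv B 1 2) (Pv B a)"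
  have "X 1 = ?R 1"
  proof (rule coord_eqI)
    show "coordP n (X 1) = coordP n (?R 1)" if "n \<in> {1..d}" for n
      using that[unfolded index_mem_2[OF \<open>d = 2\<close>]] by (elim disjE) (simp_all add: br_J)
    show "coordJ m n (X 1) = coordJ m n (?R 1)" if "m \<in> {1..d}" "n \<in> {1..d}" for m n
      using that[unfolded index_mem_2[OF \<open>d = 2\<close>]] vector_family_coordJ[OF X, of 2]
        coordJ_commute[of 2 1 "X 1"]
      by (elim disjE) (simp_all add: br_J)
  qed (use vector_family_coords[OF X] in \<open>simp_all add: br_J\<close>)
  moreover have "vector_family ?R"
    by (intro vector_family_add vector_family_scaleR vector_family_br vector_family_P
        invariant_J_2[OF \<open>d = 2\<close>])
  ultimately show ?thesis
    using vector_family_eqI[OF X] by blast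
qed

lemma PP_commutes:
  assumes "a \<in> {1..d}" "b \<in> {1..d}" "{a, b} = {1, 2} \<or> {a, b} \<inter> {1, 2} = {}"
  shows "br (Jv B a b) (br (Pv B 1) (Pv B 2)) = 0"
  using bivector_familyD[OF bivector_family_br[OF vector_family_P] assms(1,2), of 1 2] assms(3)
  by (auto simp: doubleton_eq_iff bivector_family_self[OF bivector_family_br[OF vector_family_P]])

lemma PP_12_scalar_coords:
  assumes "3 \<le> d"
  shows "coordH (br (Pv B 1) (Pv B 2)) = 0" "coordD (br (Pv B 1) (Pv B 2)) = 0"
proof -
  have "3 \<in> {1..d}"
    using assms by (simp add: atLeastAtMost_iff)
  moreover from this have "br (Pv B 1) (Pv B 2) = br (Jv B 1 3) (br (Pv B 3) (Pv B 2))"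
    by (intro bivector_family_rotate[OF bivector_family_br[OF vector_family_P]]) simp_all
  ultimately show "coordH (br (Pv B 1) (Pv B 2)) = 0" "coordD (br (Pv B 1) (Pv B 2)) = 0"
    by (simp_all add: coordH_br_J coordD_br_J)
qed

lemma PP_12_coordP:
  assumes "4 \<le> d" "n \<in> {1..d}"
  shows "coordP n (br (Pv B 1) (Pv B 2)) = 0"
proof (cases "n = 1 \<or> n = 2")
  case True
  then show ?thesis
    using coordP_eq_0_if_commutes[OF PP_commutes[of 1 2]] by auto
next
  case False
  obtain m where "m \<in> {1..d}" "m \<noteq> 1" "m \<noteq> 2" "m \<noteq> n"
    using \<open>4 \<le> d\<close> by (rule obtain_fourth_index)
  then show ?thesis
    using assms False by (intro coordP_eq_0_if_commutes(1)[of n m] PP_commutes) auto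
qed

lemma PP_12_coordJ_mixed:
  assumes "m = 1 \<or> m = 2" "n \<in> {1..d}" "n \<noteq> 1" "n \<noteq> 2"
  shows "coordJ m n (br (Pv B 1) (Pv B 2)) = 0"
  using coordJ_eq_0_if_commutes[OF PP_commutes[of 1 2], of n] assms by auto

lemma PP_12_coordJ_off:
  assumes "4 \<le> d" "m \<in> {1..d}" "n \<in> {1..d}" "m \<noteq> 1" "m \<noteq> 2" "n \<noteq> 1" "n \<noteq> 2"
    and "m \<noteq> n" "{m, n} \<noteq> {3, 4}"
  shows "coordJ m n (br (Pv B 1) (Pv B 2)) = 0"
proof -
  have "\<exists>k\<in>{3, 4}. k \<noteq> m \<and> k \<noteq> n"
    using assms(8,9) by (auto simp: doubleton_eq_iff)
  then obtain k where "k \<in> {3, 4}" "k \<noteq> m" "k \<noteq> n"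
    by blast
  moreover from this have "k \<in> {1..d}"
    using \<open>4 \<le> d\<close> by (auto simp: atLeastAtMost_iff)
  ultimately show ?thesis
    using assms(2-8) by (intro coordJ_eq_0_if_commutes(1)[of m k] PP_commutes) auto
qed

lemma PP_12_ge_4:
  assumes "4 \<le> d"
  defines "Y \<equiv> br (Pv B 1) (Pv B 2)"
  shows "Y = coordJ 1 2 Y *\<^sub>R Jv B 1 2 + coordJ 3 4 Y *\<^sub>R Jv B 3 4" (is "_ = ?R")
proof (rule coord_eqI)
  have mem: "3 \<in> {1..d}" "4 \<in> {1..d}"
    using assms by (simp_all add: atLeastAtMost_iff)
  show "coordH Y = coordH ?R" "coordD Y = coordD ?R"
    using mem assms by (simp_all add: PP_12_scalar_coords)
  show "coordP n Y = coordP n ?R" if "n \<in> {1..d}" for n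
    using that mem assms by (simp add: PP_12_coordP)
  fix m n assume mn: "m \<in> {1..d}" "n \<in> {1..d}"
  consider "m = n" | (J12) "{m, n} = {1, 2}" | (J34) "{m, n} = {3, 4}"
    | "m \<in> {1, 2}" "n \<notin> {1, 2}" | (mixed) "n \<in> {1, 2}" "m \<notin> {1, 2}"
    | "m \<notin> {1, 2}" "n \<notin> {1, 2}" "m \<noteq> n" "{m, n} \<noteq> {3, 4}"
    by blast
  then show "coordJ m n Y = coordJ m n ?R"
  proof cases
    case J12
    then show ?thesis
      using mem coordJ_commute[of 2 1 Y] by (auto simp: doubleton_eq_iff)
  next
    case mixed
    then show ?thesis
      using mn mem PP_12_coordJ_mixed[of n m] coordJ_commute[of m n Y] by (auto simp: kd_def Y_def)
  next
    case J34
    then show ?thesis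
      using mem coordJ_commute[of 4 3 Y] by (auto simp: doubleton_eq_iff)
  qed (use mn mem \<open>4 \<le> d\<close> PP_12_coordJ_off[of m n] PP_12_coordJ_mixed[of m n] in
      \<open>auto simp: doubleton_eq_iff kd_def Y_def\<close>)
qed

lemma PP_ge_4:
  assumes "4 \<le> d"
  shows "\<exists>s. \<forall>a\<in>{1..d}. \<forall>b\<in>{1..d}. br (Pv B a) (Pv B b) = s *\<^sub>R Jv B a b"
proof -
  have mem: "3 \<in> {1..d}" "4 \<in> {1..d}"
    using assms by (simp_all add: atLeastAtMost_iff)
  let ?T = "\<lambda>a b. br (Pv B a) (Pv B b)"
  have T: "bivector_family ?T"
    by (rule bivector_family_br[OF vector_family_P])
  obtain s t where T12: "?T 1 2 = s *\<^sub>R Jv B 1 2 + t *\<^sub>R Jv B 3 4"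
    using PP_12_ge_4[OF assms] by blast
  have T23: "?T 2 3 = s *\<^sub>R Jv B 2 3 + t *\<^sub>R Jv B 1 4"
    using bivector_family_rotate[OF T, of 3 2 1] mem
      br_commute[of "Pv B 2" "Pv B 3"] Jv_commute[of B 2 3]
    by (simp add: T12 br_J)
  have T31: "?T 3 1 = s *\<^sub>R Jv B 3 1 + t *\<^sub>R Jv B 2 4"
    using bivector_family_rotate[OF T, of 3 1 2] mem
      br_commute[of "Pv B 2" "Pv B 1"] Jv_commute[of B 2 1]
    by (simp add: T12 br_J)
  have "coordP 4 (br (Pv B 1) (?T 2 3) + br (Pv B 2) (?T 3 1) + br (Pv B 3) (?T 1 2)) = 0"
    by (simp add: jacobi del: coord_linear_simps) simp
  then have "t = 0"
    using mem by (simp add: T12 T23 T31 br_PJ)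
  then show ?thesis
    using bivector_family_eqI[OF T bivector_family_scaleR[OF bivector_family_J]] T12 by auto
qed

end

section \<open>Isotropic bases\<close>

definition replace_PHD :: "(lidx \<Rightarrow> 'v) \<Rightarrow> (nat \<Rightarrow> 'v) \<Rightarrow> 'v \<Rightarrow> 'v \<Rightarrow> lidx \<Rightarrow> 'v::real_vector" where
  "replace_PHD B X H D i = (case i of LJ a b \<Rightarrow> B (LJ a b) | LP a \<Rightarrow> X a | LH \<Rightarrow> H | LD \<Rightarrow> D)"

lemma replace_PHD_simps [simp]:
  "replace_PHD B X H D (LJ a b) = B (LJ a b)" "Jv (replace_PHD B X H D) a b = Jv B a b"
  "Pv (replace_PHD B X H D) a = X a" "Hv (replace_PHD B X H D) = H" "Dv (replace_PHD B X H D) = D"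
  by (simp_all add: replace_PHD_def Jv_def)

lemma Jv_shift_12:
  "Jv (B(LJ 1 2 := B (LJ 1 2) + u)) a b = Jv B a b + eps2 a b *\<^sub>R u"
  by (simp add: Jv_def eps2_def)

lemma basis_in_span:
  "i \<in> Idx d \<Longrightarrow> B i \<in> span (B ` Idx d)"
  by (simp add: span_base)

lemma Jv_in_span:
  assumes "a \<in> {1..d}" "b \<in> {1..d}"
  shows "Jv B a b \<in> span (B ` Idx d)"
  using assms
  by (auto simp: Jv_def atLeastAtMost_iff intro!: basis_in_span Idx_mem span_neg span_zero)

lemma replace_PHD_in_span:
  fixes B X H D d
  defines "S \<equiv> span (replace_PHD B X H D ` Idx d)"
  shows "a \<in> {1..d} \<Longrightarrow> b \<in> {1..d} \<Longrightarrow> Jv B a b \<in> S"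
    and "a \<in> {1..d} \<Longrightarrow> X a \<in> S" and "H \<in> S" and "D \<in> S"
  using Jv_in_span[of a d b "replace_PHD B X H D"] basis_in_span[of "LP a" d "replace_PHD B X H D"]
    basis_in_span[of LH d "replace_PHD B X H D"] basis_in_span[of LD d "replace_PHD B X H D"]
  by (simp_all add: S_def Idx_mem)

context lifshitz_algebra
begin

lemma lifshitz_algebra_replace_PHD:
  fixes X :: "nat \<Rightarrow> 'v" and H D :: 'v
  defines "B' \<equiv> replace_PHD B X H D"
  assumes "vector_family X" "invariant H" "invariant D"
    and spans_P: "\<And>a. a \<in> {1..d} \<Longrightarrow> Pv B a \<in> span (B' ` Idx d)"
    and spans_HD: "Hv B \<in> span (B' ` Idx d)" "Dv B \<in> span (B' ` Idx d)"
  shows "lifshitz_algebra d B' br"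
proof unfold_locales
  have "B (LJ a b) \<in> span (B' ` Idx d)" if "LJ a b \<in> Idx d" for a b
    using basis_in_span[OF that, of B'] by (simp add: B'_def)
  then have "B i \<in> span (B' ` Idx d)" if "i \<in> Idx d" for i
    using that spans_P spans_HD by (cases i) (auto simp: Idx_def atLeastAtMost_iff)
  then show "is_basis d B'"
    by (rule is_basis_if_spans[OF basis])
  show "common_brackets d br B'"
    using assms(2-4) unfolding common_brackets_def B'_def
    by (simp add: br_J vector_familyD invariantD)
qed (fact d_ge_2 lie)+

lemma lifshitz_algebra_rotate_HD:
  fixes x y :: real
  assumes "x \<noteq> 0 \<or> y \<noteq> 0"
  shows "lifshitz_algebra d
    (replace_PHD B (Pv B) (x *\<^sub>R Hv B + y *\<^sub>R Dv B) ((- y) *\<^sub>R Hv B + x *\<^sub>R Dv B)) br"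
proof -
  define H' where "H' = x *\<^sub>R Hv B + y *\<^sub>R Dv B"
  define D' where "D' = (- y) *\<^sub>R Hv B + x *\<^sub>R Dv B"
  define N where "N = x\<^sup>2 + y\<^sup>2"
  have N_nonzero: "N \<noteq> 0"
    using assms by (simp add: N_def sum_power2_eq_zero_iff)
  let ?S = "span (replace_PHD B (Pv B) H' D' ` Idx d)"
  have "(1 / N) *\<^sub>R (x *\<^sub>R H' + (- y) *\<^sub>R D') \<in> ?S" "(1 / N) *\<^sub>R (y *\<^sub>R H' + x *\<^sub>R D') \<in> ?S"
    by (intro span_add span_scale replace_PHD_in_span)+
  moreover have "x *\<^sub>R H' + (- y) *\<^sub>R D' = N *\<^sub>R Hv B" "y *\<^sub>R H' + x *\<^sub>R D' = N *\<^sub>R Dv B"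
    by (simp_all add: H'_def D'_def N_def power2_eq_square algebra_simps)
  ultimately have "Hv B \<in> ?S" "Dv B \<in> ?S"
    using N_nonzero by simp_all
  moreover have "invariant H'" "invariant D'"
    unfolding H'_def D'_def by (intro invariant_add invariant_scaleR invariant_H invariant_D)+
  ultimately show ?thesis
    unfolding H'_def[symmetric] D'_def[symmetric]
    by (intro lifshitz_algebra_replace_PHD vector_family_P replace_PHD_in_span)
qed

lemma br_DH_eq:
  assumes HP: "\<And>a. a \<in> {1..d} \<Longrightarrow> br (Hv B) (Pv B a) = wH *\<^sub>R Pv B a"
    and DP: "\<And>a. a \<in> {1..d} \<Longrightarrow> br (Dv B) (Pv B a) = wD *\<^sub>R Pv B a"
  shows "\<exists>zH zD. br (Dv B) (Hv B) = zH *\<^sub>R Hv B + zD *\<^sub>R Dv B"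
proof -
  let ?Z = "br (Dv B) (Hv B)"
  have Z_eq: "?Z = coordJ 1 2 ?Z *\<^sub>R Jv B 1 2 + (coordH ?Z *\<^sub>R Hv B + coordD ?Z *\<^sub>R Dv B)"
    by (intro invariant_eq invariant_br invariant_H invariant_D)
  have "br ?Z (Pv B 1) = 0"
    using br_derivation[of "Dv B" "Hv B" "Pv B 1"] by (simp add: HP DP mult.commute)
  then have "coordP 2
      (br (coordJ 1 2 ?Z *\<^sub>R Jv B 1 2 + (coordH ?Z *\<^sub>R Hv B + coordD ?Z *\<^sub>R Dv B)) (Pv B 1)) = 0"
    by (simp only: Z_eq[symmetric]) simp
  then have "coordJ 1 2 ?Z = 0"
    by (simp add: HP DP br_J)
  with Z_eq show ?thesis
    by auto
qed

end

locale isotropic_algebra = lifshitz_algebra d B br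
  for d and B :: "lidx \<Rightarrow> 'v::real_vector" and br +
  fixes s qH qD wH wD zH zD :: real
  assumes br_PP: "a \<in> {1..d} \<Longrightarrow> b \<in> {1..d} \<Longrightarrow>
      br (Pv B a) (Pv B b) = s *\<^sub>R Jv B a b + eps2 a b *\<^sub>R (qH *\<^sub>R Hv B + qD *\<^sub>R Dv B)"
    and br_HP: "a \<in> {1..d} \<Longrightarrow> br (Hv B) (Pv B a) = wH *\<^sub>R Pv B a"
    and br_DP: "a \<in> {1..d} \<Longrightarrow> br (Dv B) (Pv B a) = wD *\<^sub>R Pv B a"
    and br_DH: "br (Dv B) (Hv B) = zH *\<^sub>R Hv B + zD *\<^sub>R Dv B"

context lifshitz_algebra
begin

lemma isotropic_if_weights:
  assumes "\<forall>a\<in>{1..d}. \<forall>b\<in>{1..d}. br (Pv B a) (Pv B b) =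
      s *\<^sub>R Jv B a b + eps2 a b *\<^sub>R (qH *\<^sub>R Hv B + qD *\<^sub>R Dv B)"
    and "\<forall>a\<in>{1..d}. br (Hv B) (Pv B a) = wH *\<^sub>R Pv B a"
    and "\<forall>a\<in>{1..d}. br (Dv B) (Pv B a) = wD *\<^sub>R Pv B a"
  shows "\<exists>zH zD. isotropic_algebra d B br s qH qD wH wD zH zD"
proof -
  obtain zH zD where "br (Dv B) (Hv B) = zH *\<^sub>R Hv B + zD *\<^sub>R Dv B"
    using br_DH_eq assms(2,3) by metis
  then have "isotropic_algebra d B br s qH qD wH wD zH zD"
    using assms by unfold_locales auto
  then show ?thesis
    by blast
qed

lemma exists_isotropic_ge_4:
  assumes "4 \<le> d"
  shows "\<exists>s qH qD wH wD zH zD. isotropic_algebra d B br s qH qD wH wD zH zD"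
proof -
  have weight: "\<exists>k. \<forall>a\<in>{1..d}. br K (Pv B a) = k *\<^sub>R Pv B a" if "invariant K" for K
    using vector_family_ge_4[OF vector_family_br[OF that vector_family_P] assms] .
  obtain s where "\<forall>a\<in>{1..d}. \<forall>b\<in>{1..d}. br (Pv B a) (Pv B b) = s *\<^sub>R Jv B a b"
    using PP_ge_4[OF assms] by blast
  then have "\<forall>a\<in>{1..d}. \<forall>b\<in>{1..d}. br (Pv B a) (Pv B b) =
      s *\<^sub>R Jv B a b + eps2 a b *\<^sub>R (0 *\<^sub>R Hv B + 0 *\<^sub>R Dv B)"
    by simp
  with weight[OF invariant_H] weight[OF invariant_D] show ?thesis
    using isotropic_if_weights by metis
qed

lemma exists_PP_eq_J_3:
  assumes "d = 3"
  shows "\<exists>B' s. lifshitz_algebra d B' br \<and>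
    (\<forall>a\<in>{1..d}. \<forall>b\<in>{1..d}. br (Pv B' a) (Pv B' b) = s *\<^sub>R Jv B' a b)"
proof -
  note [simp] = index_mem_3[OF assms]
  let ?T = "\<lambda>a b. br (Pv B a) (Pv B b)"
  have hodge_J: "vector_family (hodge (Jv B))" and hodge_T: "vector_family (hodge ?T)"
    by (intro vector_family_hodge[OF assms] bivector_family_J bivector_family_br vector_family_P)+
  obtain t s where "\<forall>a\<in>{1..d}. hodge ?T a = t *\<^sub>R Pv B a + s *\<^sub>R hodge (Jv B) a"
    using vector_family_3[OF assms hodge_T] by blast
  from bspec[OF this, of 3] have P12: "br (Pv B 1) (Pv B 2) = t *\<^sub>R Pv B 3 + s *\<^sub>R Jv B 1 2"
    by (simp add: hodge_def)
  define X where "X a = Pv B a + (t / 2) *\<^sub>R hodge (Jv B) a" for a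
  have X: "vector_family X"
    unfolding X_def by (intro vector_family_add vector_family_P vector_family_scaleR hodge_J)
  let ?B' = "replace_PHD B X (Hv B) (Dv B)"
  have "Pv B a \<in> span (?B' ` Idx d)" if "a \<in> {1..d}" for a
  proof -
    have "hodge (Jv B) a \<in> span (?B' ` Idx d)"
      by (auto simp: hodge_def intro!: replace_PHD_in_span)
    then have "X a - (t / 2) *\<^sub>R hodge (Jv B) a \<in> span (?B' ` Idx d)"
      using that by (intro span_diff span_scale replace_PHD_in_span)
    then show ?thesis
      by (simp add: X_def)
  qed
  then interpret B': lifshitz_algebra d ?B' br
    by (intro lifshitz_algebra_replace_PHD X invariant_H invariant_D replace_PHD_in_span)
  have "(t / 2) *\<^sub>R Pv B 3 + (t / 2) *\<^sub>R Pv B 3 = t *\<^sub>R Pv B 3"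
    by (simp flip: scaleR_add_left)
  then have "br (X 1) (X 2) = (s - (t / 2)\<^sup>2) *\<^sub>R Jv B 1 2"
    using Jv_commute[of B 2 1]
    by (simp add: X_def P12 br_J br_PJ hodge_def power2_eq_square algebra_simps)
  then have "br (X a) (X b) = (s - (t / 2)\<^sup>2) *\<^sub>R Jv B a b" if "a \<in> {1..d}" "b \<in> {1..d}" for a b
    using bivector_family_eqI[OF bivector_family_br[OF X]
        bivector_family_scaleR[OF bivector_family_J] _ that] by blast
  then show ?thesis
    using B'.lifshitz_algebra_axioms by (intro exI[of _ ?B'] exI[of _ "s - (t / 2)\<^sup>2"]) simp
qed

lemma invariant_weight_3:
  assumes "d = 3" and K: "invariant K"
    and PP: "\<And>a b. a \<in> {1..d} \<Longrightarrow> b \<in> {1..d} \<Longrightarrow> br (Pv B a) (Pv B b) = s *\<^sub>R Jv B a b"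
  shows "\<exists>k. \<forall>a\<in>{1..d}. br K (Pv B a) = k *\<^sub>R Pv B a"
proof -
  note [simp] = index_mem_3[OF \<open>d = 3\<close>]
  obtain k l where K_P: "\<forall>a\<in>{1..d}. br K (Pv B a) = k *\<^sub>R Pv B a + l *\<^sub>R hodge (Jv B) a"
    using vector_family_3[OF \<open>d = 3\<close> vector_family_br[OF K vector_family_P]] by blast
  then have K_P12: "br K (Pv B 1) = k *\<^sub>R Pv B 1 + l *\<^sub>R Jv B 2 3"
    "br K (Pv B 2) = k *\<^sub>R Pv B 2 + l *\<^sub>R Jv B 3 1"
    by (simp_all add: hodge_def)
  have "br K (Jv B 1 2) = 0"
    using invariantD[OF K, of 1 2] br_commute[of K "Jv B 1 2"] by simp
  then have "0 = coordP 3 (br K (br (Pv B 1) (Pv B 2)))"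
    by (simp add: PP)
  also have "\<dots> = coordP 3 (br (br K (Pv B 1)) (Pv B 2) + br (Pv B 1) (br K (Pv B 2)))"
    by (subst br_derivation) (rule refl)
  also have "\<dots> = - 2 * l"
    by (simp add: K_P12 PP br_J br_PJ)
  finally show ?thesis
    using K_P by auto
qed

lemma exists_isotropic_3:
  assumes "d = 3"
  shows "\<exists>B' s qH qD wH wD zH zD. isotropic_algebra d B' br s qH qD wH wD zH zD"
proof -
  obtain B' s where B': "lifshitz_algebra d B' br"
    and PP: "\<forall>a\<in>{1..d}. \<forall>b\<in>{1..d}. br (Pv B' a) (Pv B' b) = s *\<^sub>R Jv B' a b"
    using exists_PP_eq_J_3[OF assms] by blast
  interpret B': lifshitz_algebra d B' br
    by fact
  have "\<forall>a\<in>{1..d}. \<forall>b\<in>{1..d}. br (Pv B' a) (Pv B' b) =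
      s *\<^sub>R Jv B' a b + eps2 a b *\<^sub>R (0 *\<^sub>R Hv B' + 0 *\<^sub>R Dv B')"
    using PP by simp
  moreover obtain wH wD where "\<forall>a\<in>{1..d}. br (Hv B') (Pv B' a) = wH *\<^sub>R Pv B' a"
    "\<forall>a\<in>{1..d}. br (Dv B') (Pv B' a) = wD *\<^sub>R Pv B' a"
    using B'.invariant_weight_3[OF assms] B'.invariant_H B'.invariant_D PP by meson
  ultimately show ?thesis
    using B'.isotropic_if_weights by metis
qed

lemma lifshitz_algebra_shift_J_2:
  fixes c :: real
  assumes "d = 2" and H: "\<And>x. br (Hv B) x = 0"
  shows "lifshitz_algebra d (B(LJ 1 2 := B (LJ 1 2) + c *\<^sub>R Hv B)) br"
proof unfold_locales
  let ?B' = "B(LJ 1 2 := B (LJ 1 2) + c *\<^sub>R Hv B)"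
  note [simp] = index_mem_2[OF \<open>d = 2\<close>]
  have central: "br x (Hv B) = 0" for x
    using br_commute[of x "Hv B"] H by simp
  show "is_basis d ?B'"
  proof (rule is_basis_if_spans[OF basis])
    fix i assume i: "i \<in> Idx d"
    have "c *\<^sub>R Hv B \<in> span (?B' ` Idx d)"
      using basis_in_span[of LH d ?B'] by (intro span_scale) (simp add: Idx_mem)
    then show "B i \<in> span (?B' ` Idx d)"
      using basis_in_span[OF i, of ?B'] span_diff[of "B i + c *\<^sub>R Hv B" "?B' ` Idx d" "c *\<^sub>R Hv B"]
      by (auto split: if_splits)
  qed
  show "common_brackets d br ?B'"
    using Jv_commute[of B 2 1]
    by (auto simp: common_brackets_def Jv_shift_12 H central br_J eps2_def)
qed (fact d_ge_2 lie)+

lemma PP_2: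
  assumes "d = 2"
  shows "\<exists>s qH qD. \<forall>a\<in>{1..d}. \<forall>b\<in>{1..d}. br (Pv B a) (Pv B b) =
    s *\<^sub>R Jv B a b + eps2 a b *\<^sub>R (qH *\<^sub>R Hv B + qD *\<^sub>R Dv B)"
proof -
  note [simp] = index_mem_2[OF assms]
  have "invariant (br (Pv B 1) (Pv B 2))"
    by (auto simp: invariant_def br_derivation[of "Jv B _ _"] br_J)
  then obtain s qH qD where P12: "br (Pv B 1) (Pv B 2) = s *\<^sub>R Jv B 1 2 + (qH *\<^sub>R Hv B + qD *\<^sub>R Dv B)"
    using invariant_eq by blast
  moreover have "br (Pv B 2) (Pv B 1) = s *\<^sub>R Jv B 2 1 - (qH *\<^sub>R Hv B + qD *\<^sub>R Dv B)"
    using br_commute[of "Pv B 2" "Pv B 1"] Jv_commute[of B 2 1] by (simp add: P12)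
  ultimately have "\<forall>a\<in>{1..d}. \<forall>b\<in>{1..d}. br (Pv B a) (Pv B b) =
      s *\<^sub>R Jv B a b + eps2 a b *\<^sub>R (qH *\<^sub>R Hv B + qD *\<^sub>R Dv B)"
    by (auto simp: eps2_def)
  then show ?thesis
    by blast
qed

lemma exists_scalar_weights_2:
  assumes "d = 2"
  shows "\<exists>B' wH wD. lifshitz_algebra d B' br \<and>
    (\<forall>a\<in>{1..d}. br (Hv B') (Pv B' a) = wH *\<^sub>R Pv B' a) \<and>
    (\<forall>a\<in>{1..d}. br (Dv B') (Pv B' a) = wD *\<^sub>R Pv B' a)"
proof -
  have action: "\<exists>k l. \<forall>a\<in>{1..d}. br K (Pv B a) = k *\<^sub>R Pv B a + l *\<^sub>R br (Jv B 1 2) (Pv B a)"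
    if "invariant K" for K
    using vector_family_2[OF assms vector_family_br[OF that vector_family_P]] .
  obtain wH l where H_P: "\<forall>a\<in>{1..d}. br (Hv B) (Pv B a) = wH *\<^sub>R Pv B a + l *\<^sub>R br (Jv B 1 2) (Pv B a)"
    using action[OF invariant_H] by blast
  obtain wD k where D_P: "\<forall>a\<in>{1..d}. br (Dv B) (Pv B a) = wD *\<^sub>R Pv B a + k *\<^sub>R br (Jv B 1 2) (Pv B a)"
    using action[OF invariant_D] by blast
  define H' where "H' = Hv B + (- l) *\<^sub>R Jv B 1 2"
  define D' where "D' = Dv B + (- k) *\<^sub>R Jv B 1 2"
  let ?B' = "replace_PHD B (Pv B) H' D'"
  let ?S = "span (?B' ` Idx d)"
  have "H' + l *\<^sub>R Jv B 1 2 \<in> ?S" "D' + k *\<^sub>R Jv B 1 2 \<in> ?S"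
    by (intro span_add span_scale replace_PHD_in_span; simp)+
  then have "Hv B \<in> ?S" "Dv B \<in> ?S"
    by (simp_all add: H'_def D'_def)
  moreover have "invariant H'" "invariant D'"
    unfolding H'_def D'_def
    by (intro invariant_add invariant_scaleR invariant_H invariant_D invariant_J_2[OF assms])+
  ultimately have "lifshitz_algebra d ?B' br"
    by (intro lifshitz_algebra_replace_PHD vector_family_P replace_PHD_in_span)
  moreover have "\<forall>a\<in>{1..d}. br H' (Pv B a) = wH *\<^sub>R Pv B a"
    "\<forall>a\<in>{1..d}. br D' (Pv B a) = wD *\<^sub>R Pv B a"
    using H_P D_P by (simp_all add: H'_def D'_def)
  ultimately have "lifshitz_algebra d ?B' br \<and>
      (\<forall>a\<in>{1..d}. br (Hv ?B') (Pv ?B' a) = wH *\<^sub>R Pv ?B' a) \<and>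
      (\<forall>a\<in>{1..d}. br (Dv ?B') (Pv ?B' a) = wD *\<^sub>R Pv ?B' a)"
    by simp
  then show ?thesis
    by blast
qed

lemma exists_isotropic_2:
  assumes "d = 2"
  shows "\<exists>B' s qH qD wH wD zH zD. isotropic_algebra d B' br s qH qD wH wD zH zD"
proof -
  obtain B' wH wD where "lifshitz_algebra d B' br"
    and weights: "\<forall>a\<in>{1..d}. br (Hv B') (Pv B' a) = wH *\<^sub>R Pv B' a"
      "\<forall>a\<in>{1..d}. br (Dv B') (Pv B' a) = wD *\<^sub>R Pv B' a"
    using exists_scalar_weights_2[OF assms] by blast
  then interpret B': lifshitz_algebra d B' br
    by blast
  show ?thesis
    using B'.PP_2[OF assms] B'.isotropic_if_weights[OF _ weights] by metis
qed

lemma exists_isotropic: "\<exists>B' s qH qD wH wD zH zD. isotropic_algebra d B' br s qH qD wH wD zH zD"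
proof -
  consider "d = 2" | "d = 3" | "4 \<le> d"
    using d_ge_2 by linarith
  then show ?thesis
    using exists_isotropic_2 exists_isotropic_3 exists_isotropic_ge_4 by cases blast+
qed

end

section \<open>Adapted bases\<close>

locale adapted_algebra = lifshitz_algebra d B br
  for d and B :: "lidx \<Rightarrow> 'v::real_vector" and br +
  fixes s q g z :: real
  assumes br_PP: "a \<in> {1..d} \<Longrightarrow> b \<in> {1..d} \<Longrightarrow>
      br (Pv B a) (Pv B b) = s *\<^sub>R Jv B a b + (q * eps2 a b) *\<^sub>R Hv B"
    and br_PH: "a \<in> {1..d} \<Longrightarrow> br (Pv B a) (Hv B) = 0"
    and br_DP: "a \<in> {1..d} \<Longrightarrow> br (Dv B) (Pv B a) = g *\<^sub>R Pv B a"
    and br_DH: "br (Dv B) (Hv B) = z *\<^sub>R Hv B"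

context isotropic_algebra
begin

lemma br_HD: "br (Hv B) (Dv B) = - (zH *\<^sub>R Hv B + zD *\<^sub>R Dv B)"
  using br_commute[of "Hv B" "Dv B"] by (simp add: br_DH)

lemma weight_br_DH: "zH * wH + zD * wD = 0"
proof -
  have "0 = br (br (Dv B) (Hv B)) (Pv B 1)"
    using br_derivation[of "Dv B" "Hv B" "Pv B 1"] by (simp add: br_HP br_DP mult.commute)
  also have "\<dots> = (zH * wH + zD * wD) *\<^sub>R Pv B 1"
    by (simp add: br_DH br_HP br_DP scaleR_add_left)
  finally show ?thesis
    using arg_cong[of 0 _ "coordP 1"] by fastforce
qed

lemma br_P12: "br (Pv B 1) (Pv B 2) = s *\<^sub>R Jv B 1 2 + qH *\<^sub>R Hv B + qD *\<^sub>R Dv B"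
  by (simp add: br_PP eps2_def add.assoc)

lemma weight_P12:
  shows "wD * s = 0" "- (qD * zH) = 2 * wH * qH" "- (qD * zD) = 2 * wH * qD"
    and "qH * zH = 2 * wD * qH" "qH * zD = 2 * wD * qD"
proof -
  let ?Y = "br (Pv B 1) (Pv B 2)"
  have HJ_DJ: "br (Hv B) (Jv B 1 2) = 0" "br (Dv B) (Jv B 1 2) = 0"
    using br_commute[of "Hv B" "Jv B 1 2"] br_commute[of "Dv B" "Jv B 1 2"] by (simp_all add: br_J)
  have eigen_H: "br (Hv B) ?Y = (2 * wH) *\<^sub>R ?Y" and eigen_D: "br (Dv B) ?Y = (2 * wD) *\<^sub>R ?Y"
    using br_derivation[of _ "Pv B 1" "Pv B 2"]
    by (simp_all add: br_HP br_DP scaleR_2 flip: scaleR_scaleR)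
  show "- (qD * zH) = 2 * wH * qH" "- (qD * zD) = 2 * wH * qD"
    using arg_cong[OF eigen_H, of coordH] arg_cong[OF eigen_H, of coordD]
    unfolding br_P12 by (simp_all add: HJ_DJ br_HD)
  show "wD * s = 0" "qH * zH = 2 * wD * qH" "qH * zD = 2 * wD * qD"
    using arg_cong[OF eigen_D, of "coordJ 1 2"]
      arg_cong[OF eigen_D, of coordH] arg_cong[OF eigen_D, of coordD]
    unfolding br_P12 by (simp_all add: HJ_DJ br_DH)
qed

lemma common_direction:
  obtains x y k l where "x \<noteq> 0 \<or> y \<noteq> 0" "x * wH + y * wD = 0"
    "qH = k * x" "qD = k * y" "zH = l * x" "zD = l * y"
proof -
  consider (q) "qH \<noteq> 0 \<or> qD \<noteq> 0" | (z) "qH = 0" "qD = 0" "zH \<noteq> 0 \<or> zD \<noteq> 0"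
    | (w) "qH = 0" "qD = 0" "zH = 0" "zD = 0" "wH \<noteq> 0 \<or> wD \<noteq> 0"
    | (none) "qH = 0" "qD = 0" "zH = 0" "zD = 0" "wH = 0" "wD = 0"
    by blast
  then show ?thesis
  proof cases
    case q
    show ?thesis
    proof (cases "qH = 0")
      case True
      then show ?thesis
        using q weight_P12 that[of 0 qD 1 "zD / qD"] by auto
    next
      case False
      then have "zH = 2 * wD" "wD * qD = - wH * qH"
        using weight_P12 by (auto simp: mult.commute)
      moreover have "zD = 2 * wD * qD / qH"
        using weight_P12(5) False by (simp add: field_simps)
      ultimately show ?thesis
        using False that[of qH qD 1 "2 * wD / qH"] by (simp add: mult.commute)
    qed
  next
    case z
    then show ?thesis
      using weight_br_DH that[of zH zD 0 1] by simp
  next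
    case w
    then show ?thesis
      using that[of wD "- wH" 0 0] by auto
  next
    case none
    then show ?thesis
      using that[of 1 0 0 0] by simp
  qed
qed

lemma exists_adapted: "\<exists>B' q g z. adapted_algebra d B' br s q g z"
proof -
  obtain x y k l where nonzero: "x \<noteq> 0 \<or> y \<noteq> 0" and weight_H': "x * wH + y * wD = 0"
    and q_eq: "qH = k * x" "qD = k * y" and z_eq: "zH = l * x" "zD = l * y"
    by (rule common_direction)
  define H' where "H' = x *\<^sub>R Hv B + y *\<^sub>R Dv B"
  define D' where "D' = (- y) *\<^sub>R Hv B + x *\<^sub>R Dv B"
  let ?B' = "replace_PHD B (Pv B) H' D'"
  interpret B': lifshitz_algebra d ?B' br
    unfolding H'_def D'_def by (rule lifshitz_algebra_rotate_HD[OF nonzero])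
  have "br (Pv B a) H' = 0" if "a \<in> {1..d}" for a
  proof -
    have "br H' (Pv B a) = (x * wH + y * wD) *\<^sub>R Pv B a"
      using that by (simp add: H'_def br_HP br_DP scaleR_add_left)
    then show ?thesis
      using weight_H' br_commute[of "Pv B a" H'] by simp
  qed
  moreover have "br D' (Pv B a) = (x * wD - y * wH) *\<^sub>R Pv B a" if "a \<in> {1..d}" for a
    using that by (simp add: D'_def br_HP br_DP algebra_simps)
  moreover have "br D' H' = (x\<^sup>2 + y\<^sup>2) *\<^sub>R br (Dv B) (Hv B)"
    by (simp add: D'_def H'_def power2_eq_square br_DH br_HD algebra_simps)
  then have "br D' H' = ((x\<^sup>2 + y\<^sup>2) * l) *\<^sub>R H'"
    by (simp add: br_DH z_eq H'_def algebra_simps)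
  moreover have "br (Pv B a) (Pv B b) = s *\<^sub>R Jv B a b + (k * eps2 a b) *\<^sub>R H'"
    if "a \<in> {1..d}" "b \<in> {1..d}" for a b
    using that by (simp add: br_PP q_eq H'_def algebra_simps)
  ultimately have "adapted_algebra d ?B' br s k (x * wD - y * wH) ((x\<^sup>2 + y\<^sup>2) * l)"
    by unfold_locales simp_all
  then show ?thesis
    by blast
qed

end

context adapted_algebra
begin

lemma br_DJ: "\<lbrakk>a \<in> {1..d}; b \<in> {1..d}\<rbrakk> \<Longrightarrow> br (Dv B) (Jv B a b) = 0"
  and br_HJ: "\<lbrakk>a \<in> {1..d}; b \<in> {1..d}\<rbrakk> \<Longrightarrow> br (Hv B) (Jv B a b) = 0"
  and br_HP: "a \<in> {1..d} \<Longrightarrow> br (Hv B) (Pv B a) = 0"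
  and br_PD: "a \<in> {1..d} \<Longrightarrow> br (Pv B a) (Dv B) = - (g *\<^sub>R Pv B a)"
  and br_HD: "br (Hv B) (Dv B) = - (z *\<^sub>R Hv B)"
  using br_commute[of "Hv B" "Jv B a b"] br_commute[of "Dv B" "Jv B a b"]
    br_commute[of "Hv B" "Pv B a"] br_commute[of "Pv B a" "Dv B"] br_commute[of "Hv B" "Dv B"]
  by (simp_all add: br_J br_PH br_DP br_DH)

lemmas br_table = br_J br_PJ br_DJ br_HJ br_PP br_PH br_HP br_DP br_PD br_DH br_HD

lemma isotropic: "isotropic_algebra d B br s q 0 0 g z 0"
  by unfold_locales (simp_all add: br_PP br_HP br_DP br_DH)

lemma structure_constant_relations:
  shows s_mult_g: "s * g = 0" and q_mult_z: "q * z = 2 * g * q"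
  using isotropic_algebra.weight_P12(1,4)[OF isotropic] by (simp_all add: mult.commute)

lemma d_eq_2_if_q:
  assumes "q \<noteq> 0"
  shows "d = 2"
proof (rule ccontr)
  assume "d \<noteq> 2"
  then have "coordH (br (Pv B 1) (Pv B 2)) = 0"
    using d_ge_2 by (intro PP_12_scalar_coords) simp
  then show False
    using assms by (simp add: br_PP eps2_def)
qed

lemma adapted_rescale:
  assumes "r \<noteq> 0" "x \<noteq> 0" "y \<noteq> 0"
  shows "\<exists>B'. adapted_algebra d B' br (r\<^sup>2 * s) (r\<^sup>2 * q / x) (y * g) (y * z)"
proof -
  let ?B' = "replace_PHD B (\<lambda>a. r *\<^sub>R Pv B a) (x *\<^sub>R Hv B) (y *\<^sub>R Dv B)"
  have "Pv B a \<in> span (?B' ` Idx d)" if "a \<in> {1..d}" for a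
    using span_scale[OF replace_PHD_in_span(2)[OF that, of "\<lambda>a. r *\<^sub>R Pv B a"], of "1 / r"] assms
    by simp
  moreover have "Hv B \<in> span (?B' ` Idx d)" "Dv B \<in> span (?B' ` Idx d)"
    using span_scale[OF replace_PHD_in_span(3)[of "x *\<^sub>R Hv B"], of "1 / x"]
      span_scale[OF replace_PHD_in_span(4)[of "y *\<^sub>R Dv B"], of "1 / y"] assms by simp_all
  ultimately interpret B': lifshitz_algebra d ?B' br
    by (intro lifshitz_algebra_replace_PHD vector_family_scaleR vector_family_P invariant_scaleR
        invariant_H invariant_D)
  have "adapted_algebra d ?B' br (r\<^sup>2 * s) (r\<^sup>2 * q / x) (y * g) (y * z)"
    by unfold_locales (use assms in \<open>simp_all add: br_table power2_eq_square algebra_simps\<close>)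
  then show ?thesis
    by blast
qed

lemma adapted_with_q_eq_0:
  assumes "s \<noteq> 0"
  shows "\<exists>B'. adapted_algebra d B' br s 0 g z"
proof (cases "q = 0")
  case True
  then show ?thesis
    using adapted_algebra_axioms by blast
next
  case False
  define B' where "B' = B(LJ 1 2 := B (LJ 1 2) + (q / s) *\<^sub>R Hv B)"
  have "g = 0" "z = 0"
    using structure_constant_relations assms False by auto
  have "br (Hv B) x = 0" for x
    by (rule linear_eq_on_basis[OF linear_br_right linear_zero]) (simp_all add: br_table \<open>z = 0\<close>)
  then interpret B': lifshitz_algebra d B' br
    unfolding B'_def by (rule lifshitz_algebra_shift_J_2[OF d_eq_2_if_q[OF False]])
  have "adapted_algebra d B' br s 0 g z"
    using assms
    by unfold_locales (auto simp: B'_def Jv_shift_12 br_table scaleR_add_right mult.commute)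
  then show ?thesis
    by blast
qed

end

fun pJ :: "lab \<Rightarrow> real" where
  "pJ (A4 \<sigma>) = sgn_of \<sigma>" | "pJ (A5 \<sigma>) = sgn_of \<sigma>" | "pJ _ = 0"

fun pH :: "lab \<Rightarrow> real" where
  "pH A6 = 1" | "pH A7 = 1" | "pH _ = 0"

lemma sgn_of_eq: "sgn_of \<sigma> = (if \<sigma> then 1 else - 1)"
  by (cases \<sigma>) auto

lemma pp_eq: "pp L B a b = pJ L *\<^sub>R Jv B a b + (pH L * eps2 a b) *\<^sub>R Hv B"
  by (cases L) auto

lemma realises_iff_adapted:
  assumes "2 \<le> d"
  shows "realises d L br B \<longleftrightarrow> adapted_algebra d B br (pJ L) (pH L) (dp L) (dh L)"
  using assms
  by (auto simp: realises_def pp_eq adapted_algebra_def adapted_algebra_axioms_def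
      lifshitz_algebra_def lifshitz_algebra_axioms_def indexed_basis_def lie_bracket_def)

context adapted_algebra
begin

lemma realises_rescaled:
  assumes "r \<noteq> 0" "x \<noteq> 0" "y \<noteq> 0" "valid_lab d L"
    and "r\<^sup>2 * s = pJ L" "r\<^sup>2 * q / x = pH L" "y * g = dp L" "y * z = dh L"
  shows "\<exists>L B'. valid_lab d L \<and> realises d L br B'"
  using adapted_rescale[OF assms(1-3)] assms(4-8) d_ge_2 realises_iff_adapted by metis

lemma realises_if_s_eq_0:
  assumes s: "s = 0"
  shows "\<exists>L B'. valid_lab d L \<and> realises d L br B'"
proof -
  consider (A1) "q = 0" "g = 0" "z = 0" | (A2) "q = 0" "g = 0" "z \<noteq> 0" | (A3) "q = 0" "g \<noteq> 0"
    | (A6) "q \<noteq> 0" "g = 0" | (A7) "q \<noteq> 0" "g \<noteq> 0"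
    by blast
  then show ?thesis
  proof cases
    case A1
    then show ?thesis
      using s d_ge_2 by (intro realises_rescaled[of 1 1 1 A1]) auto
  next
    case A2
    then show ?thesis
      using s d_ge_2 by (intro realises_rescaled[of 1 1 "1 / z" A2]) auto
  next
    case A3
    then show ?thesis
      using s d_ge_2 by (intro realises_rescaled[of 1 1 "1 / g" "A3 (z / g)"]) auto
  next
    case A6
    then show ?thesis
      using s d_eq_2_if_q q_mult_z by (intro realises_rescaled[of 1 q 1 A6]) auto
  next
    case A7
    then show ?thesis
      using s d_eq_2_if_q q_mult_z by (intro realises_rescaled[of 1 q "1 / g" A7]) auto
  qed
qed

lemma realises_if_s_neq_0:
  assumes s: "s \<noteq> 0" and q: "q = 0"
  shows "\<exists>L B'. valid_lab d L \<and> realises d L br B'"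
proof -
  define \<sigma> where "\<sigma> = (0 < s)"
  have r: "1 / sqrt \<bar>s\<bar> \<noteq> 0" "(1 / sqrt \<bar>s\<bar>)\<^sup>2 * s = sgn_of \<sigma>"
    using s by (auto simp: power_divide sgn_of_eq \<sigma>_def)
  have "g = 0"
    using s s_mult_g by simp
  show ?thesis
  proof (cases "z = 0")
    case True
    then show ?thesis
      using r q \<open>g = 0\<close> d_ge_2 by (intro realises_rescaled[of "1 / sqrt \<bar>s\<bar>" 1 1 "A4 \<sigma>"]) auto
  next
    case False
    then show ?thesis
      using r q \<open>g = 0\<close> d_ge_2 by (intro realises_rescaled[of "1 / sqrt \<bar>s\<bar>" 1 "1 / z" "A5 \<sigma>"]) auto
  qed
qed

lemma exists_realises: "\<exists>L B'. valid_lab d L \<and> realises d L br B'"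
  using realises_if_s_eq_0 adapted_with_q_eq_0 adapted_algebra.realises_if_s_neq_0 by metis

end

lemma lifshitz_realises:
  fixes br :: "'v::real_vector \<Rightarrow> 'v \<Rightarrow> 'v"
  assumes "2 \<le> d" "lifshitz d br B"
  shows "\<exists>L B'. valid_lab d L \<and> realises d L br B'"
proof -
  interpret lifshitz_algebra d B br
    using assms by unfold_locales (auto simp: lifshitz_def)
  show ?thesis
    using exists_isotropic isotropic_algebra.exists_adapted adapted_algebra.exists_realises by metis
qed

section \<open>An invariant form\<close>

lemma sum_kd_mult_fst:
  assumes "finite S" "a \<in> S"
  shows "(\<Sum>m\<in>S. \<Sum>n\<in>T. kd a m * f m n) = (\<Sum>n\<in>T. f a n)"
  using assms by (simp flip: sum_distrib_left)

context lifshitz_algebra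
begin

lemma formJ_br_J:
  assumes "a \<in> {1..d}" "b \<in> {1..d}"
  shows "formJ (br (Jv B a b) x) y =
    2 * (\<Sum>n\<in>{1..d}. coordJ b n x * coordJ a n y - coordJ a n x * coordJ b n y)"
proof -
  have "formJ (br (Jv B a b) x) y =
      (\<Sum>m\<in>{1..d}. \<Sum>n\<in>{1..d}. kd a m * (coordJ b n x * coordJ m n y)
        - kd b m * (coordJ a n x * coordJ m n y) - kd b n * (coordJ m a x * coordJ m n y)
        + kd a n * (coordJ m b x * coordJ m n y))"
    unfolding formJ_def using assms
    by (intro sum.cong refl) (simp add: coordJ_br_J algebra_simps)
  also have "\<dots> = (\<Sum>n\<in>{1..d}. coordJ b n x * coordJ a n y)
      - (\<Sum>n\<in>{1..d}. coordJ a n x * coordJ b n y)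
      - (\<Sum>m\<in>{1..d}. coordJ m a x * coordJ m b y) + (\<Sum>m\<in>{1..d}. coordJ m b x * coordJ m a y)"
    using assms by (simp add: sum.distrib sum_subtractf sum_kd_mult_fst)
  also have "\<dots> = 2 * (\<Sum>n\<in>{1..d}. coordJ b n x * coordJ a n y - coordJ a n x * coordJ b n y)"
    by (simp add: sum_subtractf coordJ_commute[of _ a] coordJ_commute[of _ b])
  finally show ?thesis .
qed

lemma formP_br_J:
  assumes "a \<in> {1..d}" "b \<in> {1..d}"
  shows "formP (br (Jv B a b) x) y = coordP b x * coordP a y - coordP a x * coordP b y"
proof -
  have "formP (br (Jv B a b) x) y =
      (\<Sum>n\<in>{1..d}. kd a n * (coordP b x * coordP n y) - kd b n * (coordP a x * coordP n y))"
    unfolding formP_def using assms by (intro sum.cong refl) (simp add: coordP_br_J algebra_simps)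
  then show ?thesis
    using assms by (simp add: sum_subtractf)
qed

lemma formJ_br_J_skew:
  assumes "a \<in> {1..d}" "b \<in> {1..d}"
  shows "formJ (br (Jv B a b) x) y = - formJ x (br (Jv B a b) y)"
  using formJ_commute[of x "br (Jv B a b) y"]
  by (simp add: formJ_br_J[OF assms] sum_subtractf mult.commute)

lemma formP_br_J_skew:
  assumes "a \<in> {1..d}" "b \<in> {1..d}"
  shows "formP (br (Jv B a b) x) y = - formP x (br (Jv B a b) y)"
  using formP_commute[of x "br (Jv B a b) y"] by (simp add: formP_br_J[OF assms] mult.commute)

end

context adapted_algebra
begin

lemma
  assumes "c \<in> {1..d}"
  shows coordJ_br_P: "m \<in> {1..d} \<Longrightarrow> n \<in> {1..d} \<Longrightarrow>
      coordJ m n (br (Pv B c) x) = s * (kd c m * coordP n x - kd c n * coordP m x)"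
    and coordP_br_P: "n \<in> {1..d} \<Longrightarrow> coordP n (br (Pv B c) x) = coordJ c n x - g * coordD x * kd c n"
    and coordH_br_P: "coordH (br (Pv B c) x) = q * (kd 1 c * coordP 2 x - kd 2 c * coordP 1 x)"
    and coordD_br_P: "coordD (br (Pv B c) x) = 0"
proof -
  show "coordJ m n (br (Pv B c) x) = s * (kd c m * coordP n x - kd c n * coordP m x)"
    if "m \<in> {1..d}" "n \<in> {1..d}"
    by (rule linear_eq_on_basis)
      (use that assms in \<open>auto intro!: linearI simp: br_table kd_commute algebra_simps\<close>)
  show "coordP n (br (Pv B c) x) = coordJ c n x - g * coordD x * kd c n" if "n \<in> {1..d}"
    by (rule linear_eq_on_basis)
      (use that assms in \<open>auto intro!: linearI simp: br_table kd_commute algebra_simps\<close>)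
  show "coordH (br (Pv B c) x) = q * (kd 1 c * coordP 2 x - kd 2 c * coordP 1 x)"
    by (rule linear_eq_on_basis)
      (use assms in \<open>auto intro!: linearI simp: br_table eps2_eq_kd algebra_simps\<close>)
  show "coordD (br (Pv B c) x) = 0"
    by (rule linear_eq_on_basis) (use assms in \<open>auto intro!: linearI simp: br_table\<close>)
qed

lemma
  shows coordJ_br_D: "m \<in> {1..d} \<Longrightarrow> n \<in> {1..d} \<Longrightarrow> coordJ m n (br (Dv B) x) = 0"
    and coordP_br_D: "n \<in> {1..d} \<Longrightarrow> coordP n (br (Dv B) x) = g * coordP n x"
    and coordH_br_D: "coordH (br (Dv B) x) = z * coordH x"
    and coordD_br_D: "coordD (br (Dv B) x) = 0"
  by (rule linear_eq_on_basis; auto intro!: linearI simp: br_table algebra_simps)+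

lemma br_H: "br (Hv B) x = - (z * coordD x) *\<^sub>R Hv B"
  by (rule linear_eq_on_basis[OF linear_br_right])
    (auto intro!: linearI simp: br_table algebra_simps)

lemma br_H_right: "br x (Hv B) = (z * coordD x) *\<^sub>R Hv B"
  using br_commute[of x "Hv B"] by (simp add: br_H)

lemma coordD_br: "coordD (br x y) = 0"
  by (rule linear_eq_on_basis)
    (auto intro!: linearI simp: coordD_br_P coordD_br_J br_H coordD_br_D)

lemma coordH_br: "coordH (br x y) = q * (coordP 1 x * coordP 2 y - coordP 2 x * coordP 1 y)
    + z * (coordD x * coordH y - coordD y * coordH x)" (is "_ = ?f x")
  by (rule linear_eq_on_basis[where g = ?f])
    (auto intro!: linearI simp: coordH_br_P coordH_br_J br_H coordH_br_D kd_commute algebra_simps)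

definition form :: "'v \<Rightarrow> 'v \<Rightarrow> real" where
  "form x y = formJ x y - 2 * s * formP x y"

lemma formJ_br_P:
  assumes "c \<in> {1..d}"
  shows "formJ (br (Pv B c) x) y = 2 * s * (\<Sum>n\<in>{1..d}. coordP n x * coordJ c n y)"
proof -
  have "formJ (br (Pv B c) x) y = (\<Sum>m\<in>{1..d}. \<Sum>n\<in>{1..d}.
      s * (kd c m * (coordP n x * coordJ m n y)) - s * (kd c n * (coordP m x * coordJ m n y)))"
    unfolding formJ_def using assms by (intro sum.cong refl) (simp add: coordJ_br_P algebra_simps)
  also have "\<dots> = s * (\<Sum>n\<in>{1..d}. coordP n x * coordJ c n y)
      - s * (\<Sum>m\<in>{1..d}. coordP m x * coordJ m c y)"
    using assms by (simp add: sum_subtractf sum_kd_mult_fst flip: sum_distrib_left)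
  also have "\<dots> = 2 * s * (\<Sum>n\<in>{1..d}. coordP n x * coordJ c n y)"
    by (simp add: coordJ_commute[of _ c] sum_negf)
  finally show ?thesis .
qed

lemma formP_br_P:
  assumes "c \<in> {1..d}"
  shows "formP (br (Pv B c) x) y =
    (\<Sum>n\<in>{1..d}. coordJ c n x * coordP n y) - g * coordD x * coordP c y"
proof -
  have "formP (br (Pv B c) x) y =
      (\<Sum>n\<in>{1..d}. coordJ c n x * coordP n y - g * coordD x * (kd c n * coordP n y))"
    unfolding formP_def using assms by (intro sum.cong refl) (simp add: coordP_br_P algebra_simps)
  then show ?thesis
    using assms by (simp add: sum_subtractf flip: sum_distrib_left)
qed

lemma form_br_P:
  assumes "c \<in> {1..d}"
  shows "form (br (Pv B c) x) y = - form x (br (Pv B c) y)"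
proof -
  have form_P: "form (br (Pv B c) u) v = 2 * s * ((\<Sum>n\<in>{1..d}. coordP n u * coordJ c n v)
      - (\<Sum>n\<in>{1..d}. coordP n v * coordJ c n u))" for u v
    using s_mult_g unfolding form_def formJ_br_P[OF assms] formP_br_P[OF assms]
    by (auto simp: algebra_simps)
  have "form x (br (Pv B c) y) = form (br (Pv B c) y) x"
    by (simp add: form_def formJ_commute[of x] formP_commute[of x])
  then show ?thesis
    by (simp add: form_P right_diff_distrib)
qed

lemma formJ_br_D: "formJ (br (Dv B) x) y = 0"
  by (simp add: formJ_def coordJ_br_D)

lemma formP_br_D: "formP (br (Dv B) x) y = g * formP x y"
  by (simp add: formP_def coordP_br_D sum_distrib_left mult.assoc)

lemma formJ_H: "formJ (Hv B) x = 0" and formP_H: "formP (Hv B) x = 0"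
  by (simp_all add: formJ_def formP_def)

lemma form_invariant: "form (br x y) v = - form y (br x v)"
proof (rule linear_eq_on_basis[where f = "\<lambda>x. form (br x y) v" and g = "\<lambda>x. - form y (br x v)"])
  show "form (br (Jv B a b) y) v = - form y (br (Jv B a b) v)" if "a \<in> {1..d}" "b \<in> {1..d}" for a b
    using that by (simp add: form_def formJ_br_J_skew formP_br_J_skew)
  show "form (br (Dv B) y) v = - form y (br (Dv B) v)"
    using s_mult_g
    by (auto simp: form_def formJ_br_D formP_br_D formJ_commute[of y] formP_commute[of y])
  show "form (br (Hv B) y) v = - form y (br (Hv B) v)"
    by (simp add: br_H form_def formJ_commute[of y] formP_commute[of y] formJ_H formP_H)
qed (auto intro!: linearI simp: form_br_P, auto simp: form_def algebra_simps)

lemma formP_br_self: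
  assumes coordJ_y: "\<And>m n. m \<in> {1..d} \<Longrightarrow> n \<in> {1..d} \<Longrightarrow> coordJ m n y = 0"
    and coordD_y: "coordD y = 0"
  shows "formP (br x y) y = g * coordD x * formP y y"
proof (rule linear_eq_on_basis[where f = "\<lambda>x. formP (br x y) y"
      and g = "\<lambda>x. g * coordD x * formP y y"])
  show "formP (br (Pv B c) y) y = g * coordD (Pv B c) * formP y y" if "c \<in> {1..d}" for c
    using that by (simp add: formP_br_P coordJ_y coordD_y)
qed (auto intro!: linearI simp: formP_br_J formP_br_D br_H formP_H algebra_simps)

end

section \<open>Invariants separating the algebras in the list\<close>

definition spans_ideal :: "('v::real_vector \<Rightarrow> 'v \<Rightarrow> 'v) \<Rightarrow> 'v \<Rightarrow> bool" where
  "spans_ideal br v \<longleftrightarrow> (\<forall>x. \<exists>c. br x v = c *\<^sub>R v)"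

definition has_centre :: "('v::real_vector \<Rightarrow> 'v \<Rightarrow> 'v) \<Rightarrow> bool" where
  "has_centre br \<longleftrightarrow> (\<exists>v. v \<noteq> 0 \<and> (\<forall>x. br x v = 0))"

definition has_derived_ideal :: "('v::real_vector \<Rightarrow> 'v \<Rightarrow> 'v) \<Rightarrow> bool" where
  "has_derived_ideal br \<longleftrightarrow>
    (\<exists>x y x' y'. br (br x y) (br x' y') \<noteq> 0 \<and> spans_ideal br (br (br x y) (br x' y')))"

definition hyperbolic :: "('v::real_vector \<Rightarrow> 'v \<Rightarrow> 'v) \<Rightarrow> 'v \<Rightarrow> bool" where
  "hyperbolic br x \<longleftrightarrow> (\<exists>y. \<not> spans_ideal br y \<and> br x y = y)"

definition has_parabolic :: "('v::real_vector \<Rightarrow> 'v \<Rightarrow> 'v) \<Rightarrow> bool" where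
  "has_parabolic br \<longleftrightarrow> (\<exists>x y. br x (br x y) = 0 \<and> \<not> spans_ideal br (br x y))"

context adapted_algebra
begin

lemma invariant_if_spans_ideal:
  assumes "spans_ideal br v"
  shows "invariant v"
  unfolding invariant_def
proof (intro ballI)
  fix a b assume ab: "a \<in> {1..d}" "b \<in> {1..d}"
  obtain c where eigen: "br (Jv B a b) v = c *\<^sub>R v"
    using assms by (auto simp: spans_ideal_def)
  have "v = 0" if "c \<noteq> 0"
  proof (rule coord_eqI)
    have "formJ v v = 0" "formP v v = 0"
      using formJ_br_J_skew[OF ab, of v v] formP_br_J_skew[OF ab, of v v] that by (simp_all add: eigen)
    then show "coordJ m n v = coordJ m n 0" "coordP n v = coordP n 0"
      if "m \<in> {1..d}" "n \<in> {1..d}" for m n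
      using that by (simp_all add: formJ_self_eq_0 formP_self_eq_0)
    show "coordH v = coordH 0" "coordD v = coordD 0"
      using coordH_br_J[OF ab, of v] coordD_br_J[OF ab, of v] that by (simp_all add: eigen)
  qed
  then show "br (Jv B a b) v = 0"
    using eigen by auto
qed

lemma spans_ideal_coords:
  assumes v: "spans_ideal br v"
  shows spans_ideal_coordJ: "m \<in> {1..d} \<Longrightarrow> n \<in> {1..d} \<Longrightarrow> coordJ m n v = 0"
    and spans_ideal_coordP: "n \<in> {1..d} \<Longrightarrow> coordP n v = 0"
    and "g * coordD v = 0"
proof -
  show coordP_v: "coordP n v = 0" if "n \<in> {1..d}" for n
    using invariant_coordP[OF invariant_if_spans_ideal[OF v] that] .
  have coordJ_v: "coordJ m n v = g * coordD v * kd m n" if mn: "m \<in> {1..d}" "n \<in> {1..d}" for m n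
  proof -
    obtain c where "br (Pv B m) v = c *\<^sub>R v"
      using v by (auto simp: spans_ideal_def)
    then show ?thesis
      using coordP_br_P[OF mn, of v] coordP_v[OF mn(2)] by simp
  qed
  then show coordD_v: "g * coordD v = 0"
    using coordJ_v[of 1 1] by simp
  show "coordJ m n v = 0" if "m \<in> {1..d}" "n \<in> {1..d}"
    using coordJ_v[OF that] coordD_v by simp
qed

lemma br_eq_weight_if_coords_0:
  assumes "\<And>m n. m \<in> {1..d} \<Longrightarrow> n \<in> {1..d} \<Longrightarrow> coordJ m n v = 0"
    and "\<And>n. n \<in> {1..d} \<Longrightarrow> coordP n v = 0" and "coordD v = 0"
  shows "br x v = (z * coordD x) *\<^sub>R v"
proof -
  have v: "v = coordH v *\<^sub>R Hv B"
    by (rule coord_eqI) (simp_all add: assms)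
  show ?thesis
    by (subst (1 2) v) (simp add: br_H_right mult.commute)
qed

lemma spans_idealI:
  assumes "\<And>m n. m \<in> {1..d} \<Longrightarrow> n \<in> {1..d} \<Longrightarrow> coordJ m n v = 0"
    and "\<And>n. n \<in> {1..d} \<Longrightarrow> coordP n v = 0" and "coordD v = 0"
  shows "spans_ideal br v"
  using br_eq_weight_if_coords_0[OF assms] unfolding spans_ideal_def by blast

lemma spans_ideal_H: "spans_ideal br (Hv B)"
  by (rule spans_idealI) simp_all

lemma H_nonzero: "Hv B \<noteq> 0"
  using coordH_basis(3) by force

lemma not_spans_ideal_P: "a \<in> {1..d} \<Longrightarrow> \<not> spans_ideal br (Pv B a)"
  using spans_ideal_coordP[of "Pv B a" a] by auto

lemma has_centre_iff: "has_centre br \<longleftrightarrow> z = 0"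
proof
  assume "has_centre br"
  then obtain v where v: "v \<noteq> 0" "\<forall>x. br x v = 0"
    by (auto simp: has_centre_def)
  then have ideal: "spans_ideal br v"
    unfolding spans_ideal_def by (metis scaleR_zero_left)
  show "z = 0"
  proof (rule ccontr)
    assume "z \<noteq> 0"
    then have "coordH v = 0" "coordD v = 0"
      using coordH_br_D[of v] br_H[of v] v H_nonzero by simp_all
    then have "v = 0"
      by (intro coord_eqI) (simp_all add: spans_ideal_coords[OF ideal])
    then show False
      using v by simp
  qed
next
  assume "z = 0"
  then have "br x (Hv B) = 0" for x
    by (simp add: br_H_right)
  then show "has_centre br"
    unfolding has_centre_def using H_nonzero by blast
qed

lemma q_nonzero_if_has_derived_ideal:
  assumes "has_derived_ideal br"
  shows "q \<noteq> 0"
proof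
  assume "q = 0"
  obtain x y x' y' where nonzero: "br (br x y) (br x' y') \<noteq> 0"
    and ideal: "spans_ideal br (br (br x y) (br x' y'))"
    using assms by (auto simp: has_derived_ideal_def)
  have "br (br x y) (br x' y') = 0"
    by (intro coord_eqI) (simp_all add: spans_ideal_coords[OF ideal] coordH_br coordD_br \<open>q = 0\<close>)
  then show False
    using nonzero by simp
qed

lemma has_derived_ideal_if_q_nonzero:
  assumes "s = 0" "q \<noteq> 0"
  shows "has_derived_ideal br"
proof -
  have "br (br (Jv B 1 2) (Pv B 2)) (br (Jv B 1 2) (Pv B 1)) = (- q) *\<^sub>R Hv B"
    using assms by (simp add: br_table eps2_def)
  moreover have "spans_ideal br ((- q) *\<^sub>R Hv B)"
    by (rule spans_idealI) simp_all
  ultimately show ?thesis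
    unfolding has_derived_ideal_def using assms H_nonzero
    by (metis neg_equal_0_iff_equal scaleR_eq_0_iff)
qed

lemma hyperbolic_coordD:
  assumes "s \<le> 0" "hyperbolic br x"
  shows "g * coordD x = 1"
proof -
  obtain y where not_ideal: "\<not> spans_ideal br y" and eigen: "br x y = y"
    using assms(2) by (auto simp: hyperbolic_def)
  have coordD_y: "coordD y = 0"
    using coordD_br[of x y] eigen by simp
  have "form y y = 0"
    using form_invariant[of x y y] eigen by simp
  then have "formJ y y = 2 * s * formP y y"
    by (simp add: form_def)
  also have "\<dots> \<le> 0"
    using assms(1) formP_nonneg[of y] by (simp add: mult_nonpos_nonneg)
  finally have "formJ y y = 0"
    using formJ_nonneg[of y] by simp
  then have coordJ_y: "coordJ m n y = 0" if "m \<in> {1..d}" "n \<in> {1..d}" for m n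
    using that by (rule formJ_self_eq_0)
  have "formP y y = g * coordD x * formP y y"
    using formP_br_self[OF coordJ_y coordD_y, of x] eigen by simp
  moreover have "formP y y \<noteq> 0"
    using not_ideal spans_idealI[OF coordJ_y _ coordD_y] formP_self_eq_0 by blast
  ultimately show ?thesis
    by simp
qed

lemma hyperbolic_P:
  assumes "t\<^sup>2 * s = 1" "q = 0"
  shows "hyperbolic br (t *\<^sub>R Pv B 1)"
proof -
  let ?y = "Jv B 1 2 + t *\<^sub>R Pv B 2"
  have "br (t *\<^sub>R Pv B 1) ?y = t *\<^sub>R Pv B 2 + (t\<^sup>2 * s) *\<^sub>R Jv B 1 2"
    using assms(2) by (simp add: br_table power2_eq_square mult.assoc)
  then have "br (t *\<^sub>R Pv B 1) ?y = ?y"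
    by (simp add: assms(1))
  moreover have "\<not> spans_ideal br ?y"
    using spans_ideal_coordJ[of ?y 1 2] by auto
  ultimately show ?thesis
    unfolding hyperbolic_def by blast
qed

lemma hyperbolic_D:
  assumes "g \<noteq> 0"
  shows "hyperbolic br ((1 / g) *\<^sub>R Dv B)"
  unfolding hyperbolic_def using assms not_spans_ideal_P[of 1]
  by (intro exI[of _ "Pv B 1"]) (simp add: br_DP)

lemma hyperbolic_opposite_iff:
  assumes "q = 0"
  shows "(\<exists>x. hyperbolic br x \<and> hyperbolic br (- x)) \<longleftrightarrow> 0 < s"
proof
  assume "\<exists>x. hyperbolic br x \<and> hyperbolic br (- x)"
  then obtain x where x: "hyperbolic br x" "hyperbolic br (- x)"
    by blast
  show "0 < s"
  proof (rule ccontr)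
    assume "\<not> 0 < s"
    then show False
      using hyperbolic_coordD[OF _ x(1)] hyperbolic_coordD[OF _ x(2)] by simp
  qed
next
  assume "0 < s"
  then have "(1 / sqrt s)\<^sup>2 * s = 1" "(- (1 / sqrt s))\<^sup>2 * s = 1"
    by (simp_all add: power_divide)
  then show "\<exists>x. hyperbolic br x \<and> hyperbolic br (- x)"
    using hyperbolic_P[OF _ assms] by (metis scaleR_minus_left)
qed

lemma exists_hyperbolic_iff:
  assumes "q = 0"
  shows "(\<exists>x. hyperbolic br x) \<longleftrightarrow> 0 < s \<or> g \<noteq> 0"
  using hyperbolic_opposite_iff[OF assms] hyperbolic_D hyperbolic_coordD
  by (metis linorder_not_less mult_zero_left zero_neq_one)

lemma has_parabolic_iff:
  assumes "q = 0" "s \<le> 0"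
  shows "has_parabolic br \<longleftrightarrow> s = 0"
proof
  assume "has_parabolic br"
  then obtain x y where sq: "br x (br x y) = 0" and not_ideal: "\<not> spans_ideal br (br x y)"
    by (auto simp: has_parabolic_def)
  show "s = 0"
  proof (rule ccontr)
    assume "s \<noteq> 0"
    then have "s < 0"
      using assms(2) by simp
    have "form (br x y) (br x y) = 0"
      using form_invariant[of x y "br x y"] sq by (simp add: form_def)
    then have "formJ (br x y) (br x y) = 2 * s * formP (br x y) (br x y)"
      by (simp add: form_def)
    then have "formP (br x y) (br x y) = 0" "formJ (br x y) (br x y) = 0"
      using formJ_nonneg[of "br x y"] formP_nonneg[of "br x y"] \<open>s < 0\<close>
        mult_neg_pos[of s "formP (br x y) (br x y)"] by fastforce+
    then have "spans_ideal br (br x y)"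
      by (intro spans_idealI formJ_self_eq_0 formP_self_eq_0 coordD_br)
    then show False
      using not_ideal by blast
  qed
next
  assume "s = 0"
  then have "br (Pv B 1) (br (Pv B 1) (Jv B 1 2)) = 0" "br (Pv B 1) (Jv B 1 2) = Pv B 2"
    using assms by (simp_all add: br_table)
  then show "has_parabolic br"
    unfolding has_parabolic_def using not_spans_ideal_P[of 2] by (metis two_mem)
qed

lemma spans_ideal_weight:
  assumes "g \<noteq> 0" "spans_ideal br v"
  shows "br x v = (z * coordD x) *\<^sub>R v"
  using spans_ideal_coords[OF assms(2)] assms(1) by (intro br_eq_weight_if_coords_0) simp_all

end

lemma lab_eqI:
  assumes "pH L = 0 \<longleftrightarrow> pH L' = 0" "dh L = 0 \<longleftrightarrow> dh L' = 0"
    and "pH L = 0 \<Longrightarrow> 0 < pJ L \<longleftrightarrow> 0 < pJ L'"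
    and "pH L = 0 \<Longrightarrow> pJ L = 0 \<longleftrightarrow> pJ L' = 0"
    and "pH L = 0 \<Longrightarrow> dp L = 0 \<longleftrightarrow> dp L' = 0"
    and "pH L = 0 \<Longrightarrow> dp L \<noteq> 0 \<Longrightarrow> dh L = dh L'"
  shows "L = L'"
  using assms by (cases L; cases L') (auto simp: sgn_of_eq split: if_splits)

lemma lab_constant_relations:
  shows "pH L \<noteq> 0 \<Longrightarrow> pJ L = 0" and "dp L \<noteq> 0 \<Longrightarrow> dp L = 1" and "dp L \<noteq> 0 \<Longrightarrow> pJ L = 0"
  by (cases L; simp)+

lemma realises_unique:
  fixes br :: "'v::real_vector \<Rightarrow> 'v \<Rightarrow> 'v"
  assumes "2 \<le> d" "realises d L br B" "realises d L' br B'"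
  shows "L = L'"
proof (rule lab_eqI)
  interpret R: adapted_algebra d B br "pJ L" "pH L" "dp L" "dh L"
    using assms realises_iff_adapted by blast
  interpret R': adapted_algebra d B' br "pJ L'" "pH L'" "dp L'" "dh L'"
    using assms realises_iff_adapted by blast
  show pH_iff: "pH L = 0 \<longleftrightarrow> pH L' = 0"
    using R.q_nonzero_if_has_derived_ideal R'.q_nonzero_if_has_derived_ideal
      R.has_derived_ideal_if_q_nonzero R'.has_derived_ideal_if_q_nonzero
      lab_constant_relations(1) by metis
  show "dh L = 0 \<longleftrightarrow> dh L' = 0"
    using R.has_centre_iff R'.has_centre_iff by blast
  assume "pH L = 0"
  then have pH_0: "pH L = 0" "pH L' = 0"
    using pH_iff by simp_all
  show pos_iff: "0 < pJ L \<longleftrightarrow> 0 < pJ L'"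
    using R.hyperbolic_opposite_iff R'.hyperbolic_opposite_iff pH_0 by blast
  show "pJ L = 0 \<longleftrightarrow> pJ L' = 0"
    using R.has_parabolic_iff R'.has_parabolic_iff pH_0 pos_iff
    by (metis linorder_not_less order_less_irrefl)
  show dp_iff: "dp L = 0 \<longleftrightarrow> dp L' = 0"
    using R.exists_hyperbolic_iff R'.exists_hyperbolic_iff pH_0 pos_iff lab_constant_relations(3)
    by (metis order_less_irrefl)
  assume "dp L \<noteq> 0"
  then have "dp L = 1" "dp L' = 1" "pJ L' = 0"
    using dp_iff lab_constant_relations by simp_all
  then have "R'.coordD (Dv B) = 1"
    using R'.hyperbolic_coordD[of "Dv B"] R.hyperbolic_D by simp
  then have "br (Dv B) (Hv B) = dh L' *\<^sub>R Hv B"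
    using R'.spans_ideal_weight[OF _ R.spans_ideal_H] \<open>dp L' = 1\<close> by simp
  then show "dh L = dh L'"
    using R.br_DH R.H_nonzero by simp
qed

section \<open>Transport along isomorphisms\<close>

lemma lie_iso_inverse:
  assumes "lie_iso br br' f"
  shows "\<exists>g. lie_iso br' br g"
proof -
  have "linear f" "bij f" and hom: "f (br x y) = br' (f x) (f y)" for x y
    using assms by (auto simp: lie_iso_def)
  obtain g where "linear g" and gf: "g \<circ> f = id"
    using linear_injective_left_inverse[OF \<open>linear f\<close>] \<open>bij f\<close> by (auto simp: bij_def)
  have "f \<circ> g = id"
    using \<open>bij f\<close> gf by (metis bij_is_surj comp_id fun.map_comp fun.map_id surj_iff)
  then have "bij g"
    using gf o_bij by blast
  moreover have "g (br' x y) = br (g x) (g y)" for x y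
    using hom[of "g x" "g y"] gf \<open>f \<circ> g = id\<close> by (metis comp_apply id_apply)
  ultimately show ?thesis
    using \<open>linear g\<close> by (auto simp: lie_iso_def)
qed

lemma realises_image:
  assumes "lie_algebra br" and g: "lie_iso br' br g" and B: "realises d L br' B"
  shows "realises d L br (g \<circ> B)"
proof -
  have lin: "linear g" and "bij g" and hom: "br (g x) (g y) = g (br' x y)" for x y
    using g by (simp_all add: lie_iso_def)
  have Jv_image: "Jv (g \<circ> B) a b = g (Jv B a b)" for a b
    by (simp add: Jv_def linear_neg[OF lin] linear_0[OF lin])
  have pp_image: "pp L (g \<circ> B) a b = g (pp L B a b)" for a b
    by (simp add: pp_eq Jv_image linear_add[OF lin] linear_scale[OF lin])
  note linear = linear_add[OF lin] linear_diff[OF lin] linear_scale[OF lin] linear_0[OF lin]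
  have "common_brackets d br (g \<circ> B)"
    using B unfolding realises_def common_brackets_def Jv_image comp_apply hom
    by (simp add: linear)
  then show ?thesis
    using B assms(1) is_basis_image[OF _ lin \<open>bij g\<close>] unfolding realises_def pp_image
    by (simp add: hom linear)
qed

theorem theorem3p2:
  fixes d :: nat and br :: "'v::real_vector \<Rightarrow> 'v \<Rightarrow> 'v" and B :: "lidx \<Rightarrow> 'v"
  assumes "2 \<le> d" and "lifshitz d br B"
  shows "\<exists>!L. valid_lab d L \<and>
           (\<exists>(br' :: 'v \<Rightarrow> 'v \<Rightarrow> 'v) B' f. realises d L br' B' \<and> lie_iso br br' f)"
proof -
  have lie: "lie_algebra br"
    using assms(2) by (simp add: lifshitz_def)
  obtain L B' where L: "valid_lab d L" "realises d L br B'"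
    using lifshitz_realises[OF assms] by blast
  have "lie_iso br br id"
    by (simp add: lie_iso_def linear_id)
  with L show ?thesis
  proof (intro ex1I[of _ L] conjI)
    fix M assume "valid_lab d M \<and>
      (\<exists>(br' :: 'v \<Rightarrow> 'v \<Rightarrow> 'v) B' f. realises d M br' B' \<and> lie_iso br br' f)"
    then obtain br' :: "'v \<Rightarrow> 'v \<Rightarrow> 'v" and B'' f where "realises d M br' B''" "lie_iso br br' f"
      by blast
    then show "M = L"
      using lie_iso_inverse realises_image[OF lie] realises_unique[OF assms(1) _ L(2)] by metis
  qed blast+
qed

end
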